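(* Let $K$ be a field of characteristic different from $2$ and $n = 2k$, where $k \geq 1$ is odd. Let $L$ be any cyclic Galois extension of $K$ of degree $n$ with Galois group $G = \langle \sigma \rangle$. Then for each $i$ with $1 \leq i \leq k-1$ and $\mathrm{ord}(\sigma^i)$ even (and $\neq 2$) there are $K$-subspaces $\mathcal{U}_i, \mathcal{V}_i$ of $A^i$, where $\mathcal{U}_i$ is an $n$-subspace of dimension $n/2$ and $\mathcal{V}_i$ is an $(n - 2n/\mathrm{ord}(\sigma^i))$-subspace of dimension $n/2$, such that $$\mathrm{Alt}_K(L) = B^1 \oplus \left( \bigoplus_{\substack{\mathrm{ord}(\sigma^i) \equiv 0 \ (\mathrm{mod}\ 2)\\ \mathrm{ord}(\sigma^i) \neq 2}} (\mathcal{U}_i \oplus \mathcal{V}_i) \right) \oplus \left( \bigoplus_{\mathrm{ord}(\sigma^i) \equiv 1\ (\mathrm{mod}\ 2)} A^i \right),$$ where the index $i$ ranges over $1 \leq i \leq k-1$.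
   Context: For a finite Galois extension $L/K$, $\mathrm{Alt}_K(L)$ denotes the $K$-space of alternating $K$-bilinear forms (skew-forms) $L \times L \to K$, and $\mathrm{Tr}^L_K(a) = \sum_{\theta \in \mathrm{Gal}(L/K)} \theta(a)$. For $\tau \in \mathrm{Gal}(L/K)$ and $b \in L$ define the skew-form $f_{b,\tau}(x,y) = \mathrm{Tr}^L_K\big(b(x\tau(y) - \tau(x)y)\big)$ for $x,y \in L$, and the subspace $A^{\tau} = \{ f_{b,\tau} : b \in L\}$ of $\mathrm{Alt}_K(L)$. If $\mathrm{Gal}(L/K) = \langle \sigma\rangle$ is cyclic of even order $n$, write $A^i = A^{\sigma^i}$ and $B^1 = A^{\sigma^{n/2}}$. An $r$-subspace of $\mathrm{Alt}_K(L)$ is a $K$-subspace all of whose nonzero skew-forms have rank $r$. Dimensions are over $K$, and $\mathrm{ord}(\tau)$ is the order of $\tau$. *)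

theory Defs
  imports "HOL-Algebra.Algebra" "HOL-Library.Function_Algebras" "HOL-Library.FuncSet"
begin

text \<open>
  A field extension \<open>L/K\<close> is given by two fields \<open>'k\<close>, \<open>'l\<close> and an embedding
  \<open>\<iota> : K \<rightarrow> L\<close>. All dimensions and subspaces are those of the library locales
  \<^locale>\<open>vector_space\<close> and \<open>module\<close>, over the scalar type \<open>'k\<close>.
\<close>

locale field_extension =
  fixes \<iota> :: "'k::field \<Rightarrow> 'l::field"
  assumes hom_one: "\<iota> 1 = 1"
    and hom_add: "\<iota> (a + b) = \<iota> a + \<iota> b"
    and hom_mult: "\<iota> (a * b) = \<iota> a * \<iota> b"

definition ext_scale :: "('k::field \<Rightarrow> 'l::field) \<Rightarrow> 'k \<Rightarrow> 'l \<Rightarrow> 'l" where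
  "ext_scale \<iota> c x = \<iota> c * x"

definition degree_ext :: "('k::field \<Rightarrow> 'l::field) \<Rightarrow> nat" where
  "degree_ext \<iota> = vector_space.dim (ext_scale \<iota>) UNIV"

definition Gal :: "('k::field \<Rightarrow> 'l::field) \<Rightarrow> ('l \<Rightarrow> 'l) monoid" where
  "Gal \<iota> = \<lparr>carrier = {\<theta>. bij \<theta> \<and> (\<forall>x y. \<theta> (x + y) = \<theta> x + \<theta> y) \<and>
                        (\<forall>x y. \<theta> (x * y) = \<theta> x * \<theta> y) \<and> (\<forall>c. \<theta> (\<iota> c) = \<iota> c)},
          monoid.mult = (\<circ>), one = id\<rparr>"

text \<open>Finite-dimensionality is stated separately because \<open>dim\<close> is \<open>0\<close> on
  infinite-dimensional spaces. Galois means that the fixed field of the automorphism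
  group is (the image of) \<open>K\<close>.\<close>

definition finite_galois :: "('k::field \<Rightarrow> 'l::field) \<Rightarrow> bool" where
  "finite_galois \<iota> \<longleftrightarrow> field_extension \<iota> \<and>
     (\<exists>B. finite B \<and> Modules.module.span (ext_scale \<iota>) B = UNIV) \<and>
     {x. \<forall>\<theta>\<in>carrier (Gal \<iota>). \<theta> x = x} = range \<iota>"

text \<open>The sum of all conjugates lies in \<open>range \<iota>\<close> for a Galois extension (lemma
  \<open>embed_Tr\<close> below); the trace is the corresponding element of \<open>K\<close>.\<close>

definition Tr :: "('k::field \<Rightarrow> 'l::field) \<Rightarrow> 'l \<Rightarrow> 'k" where
  "Tr \<iota> a = the_inv \<iota> (\<Sum>\<theta>\<in>carrier (Gal \<iota>). \<theta> a)"

definition Alt :: "('k::field \<Rightarrow> 'l::field) \<Rightarrow> ('l \<Rightarrow> 'l \<Rightarrow> 'k) set" where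
  "Alt \<iota> = {f. (\<forall>x. Vector_Spaces.linear (ext_scale \<iota>) (*) (\<lambda>y. f x y)) \<and>
               (\<forall>y. Vector_Spaces.linear (ext_scale \<iota>) (*) (\<lambda>x. f x y)) \<and>
               (\<forall>x. f x x = 0)}"

definition form_scale :: "'k::field \<Rightarrow> ('l \<Rightarrow> 'l \<Rightarrow> 'k) \<Rightarrow> ('l \<Rightarrow> 'l \<Rightarrow> 'k)" where
  "form_scale c f = (\<lambda>x y. c * f x y)"

abbreviation form_subspace :: "('l \<Rightarrow> 'l \<Rightarrow> 'k::field) set \<Rightarrow> bool" where
  "form_subspace \<equiv> Modules.module.subspace form_scale"

abbreviation form_dim :: "('l \<Rightarrow> 'l \<Rightarrow> 'k::field) set \<Rightarrow> nat" where
  "form_dim \<equiv> vector_space.dim form_scale"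

definition radical :: "('l \<Rightarrow> 'l \<Rightarrow> 'k::field) \<Rightarrow> 'l set" where
  "radical f = {x. \<forall>y. f x y = 0}"

definition form_rank :: "('k::field \<Rightarrow> 'l::field) \<Rightarrow> ('l \<Rightarrow> 'l \<Rightarrow> 'k) \<Rightarrow> nat" where
  "form_rank \<iota> f = degree_ext \<iota> - vector_space.dim (ext_scale \<iota>) (radical f)"

definition rank_subspace ::
    "('k::field \<Rightarrow> 'l::field) \<Rightarrow> nat \<Rightarrow> ('l \<Rightarrow> 'l \<Rightarrow> 'k) set \<Rightarrow> bool" where
  "rank_subspace \<iota> r U \<longleftrightarrow> U \<subseteq> Alt \<iota> \<and> form_subspace U \<and>
     (\<forall>f\<in>U. f \<noteq> 0 \<longrightarrow> form_rank \<iota> f = r)"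

definition skew_form :: "('k::field \<Rightarrow> 'l::field) \<Rightarrow> 'l \<Rightarrow> ('l \<Rightarrow> 'l) \<Rightarrow> ('l \<Rightarrow> 'l \<Rightarrow> 'k)" where
  "skew_form \<iota> b \<tau> = (\<lambda>x y. Tr \<iota> (b * (x * \<tau> y - \<tau> x * y)))"

definition A_space :: "('k::field \<Rightarrow> 'l::field) \<Rightarrow> ('l \<Rightarrow> 'l) \<Rightarrow> ('l \<Rightarrow> 'l \<Rightarrow> 'k) set" where
  "A_space \<iota> \<tau> = {skew_form \<iota> b \<tau> | b. True}"

text \<open>\<open>V\<close> is the internal direct sum of the finite family \<open>W j\<close>, \<open>j \<in> I\<close>: the summation
  map from the product of the family to \<open>V\<close> is a bijection.\<close>

definition internal_direct_sum :: "'v::ab_group_add set \<Rightarrow> 'i set \<Rightarrow> ('i \<Rightarrow> 'v set) \<Rightarrow> bool" where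
  "internal_direct_sum V I W \<longleftrightarrow>
     finite I \<and> bij_betw (\<lambda>w. \<Sum>j\<in>I. w j) (Pi\<^sub>E I W) V"

text \<open>Names for the summands \<open>B\<^sup>1\<close>, \<open>\<U>\<^sub>i\<close>, \<open>\<V>\<^sub>i\<close> and \<open>A\<^sup>i\<close>, so that they form one family.\<close>

datatype summand = SB | SU nat | SV nat | SA nat

lemma (in field_extension) vector_space_ext_scale: "vector_space (ext_scale \<iota>)"
  by unfold_locales (simp_all add: ext_scale_def hom_one hom_add hom_mult algebra_simps)

lemma vector_space_form_scale: "vector_space form_scale"
  by unfold_locales (simp_all add: form_scale_def fun_eq_iff algebra_simps)

lemma group_Gal: "group (Gal \<iota>)"
proof (rule groupI)
  fix \<theta> assume "\<theta> \<in> carrier (Gal \<iota>)"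
  then have \<theta>: "bij \<theta>" "\<And>x y. \<theta> (x + y) = \<theta> x + \<theta> y" "\<And>x y. \<theta> (x * y) = \<theta> x * \<theta> y"
    "\<And>c. \<theta> (\<iota> c) = \<iota> c"
    by (auto simp: Gal_def)
  obtain \<psi> where \<psi>: "\<And>z. \<psi> (\<theta> z) = z" "\<And>z. \<theta> (\<psi> z) = z" "bij \<psi>"
    using \<theta>(1) by (metis bij_betw_def bij_imp_bij_inv bij_is_inj inv_f_f surj_f_inv_f)
  have "\<psi> (x + y) = \<psi> x + \<psi> y" "\<psi> (x * y) = \<psi> x * \<psi> y" "\<psi> (\<iota> c) = \<iota> c" for x y c
    using \<theta> \<psi> by metis+
  then have "\<psi> \<in> carrier (Gal \<iota>)"
    using \<psi>(3) by (simp add: Gal_def)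
  moreover have "\<psi> \<circ> \<theta> = id"
    using \<psi>(1) by (simp add: fun_eq_iff)
  ultimately show "\<exists>\<theta>'\<in>carrier (Gal \<iota>). \<theta>' \<otimes>\<^bsub>Gal \<iota>\<^esub> \<theta> = \<one>\<^bsub>Gal \<iota>\<^esub>"
    by (auto simp: Gal_def)
qed (auto simp: Gal_def bij_comp comp_assoc)

lemma (in field_extension) inj_embedding: "inj \<iota>"
proof (rule injI, rule ccontr)
  fix a b assume eq: "\<iota> a = \<iota> b" and "a \<noteq> b"
  have "\<iota> (a - b) + \<iota> b = \<iota> a"
    using hom_add[of "a - b" b] by simp
  then have "\<iota> (a - b) = 0"
    using eq by simp
  then have "\<iota> ((a - b) * inverse (a - b)) = 0"
    by (simp only: hom_mult mult_zero_left)
  then show False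
    using \<open>a \<noteq> b\<close> hom_one by simp
qed

lemma embed_Tr:
  assumes "finite_galois \<iota>"
  shows "\<iota> (Tr \<iota> a) = (\<Sum>\<theta>\<in>carrier (Gal \<iota>). \<theta> a)"
proof -
  interpret field_extension \<iota>
    using assms by (simp add: finite_galois_def)
  interpret G: group "Gal \<iota>"
    by (rule group_Gal)
  let ?s = "\<Sum>\<theta>\<in>carrier (Gal \<iota>). \<theta> a"
  have "\<phi> ?s = ?s" if \<phi>: "\<phi> \<in> carrier (Gal \<iota>)" for \<phi>
  proof -
    have add: "\<phi> (x + y) = \<phi> x + \<phi> y" for x y
      using \<phi> by (simp add: Gal_def)
    then have zero: "\<phi> 0 = 0"
      by (metis add_cancel_right_right)
    have "\<phi> ?s = (\<Sum>\<theta>\<in>carrier (Gal \<iota>). \<phi> (\<theta> a))"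
      using sum_comp_morphism[of \<phi> "\<lambda>\<theta>. \<theta> a", OF zero add] by (simp add: o_def)
    also have "\<dots> = (\<Sum>\<theta>\<in>carrier (Gal \<iota>). (\<phi> \<otimes>\<^bsub>Gal \<iota>\<^esub> \<theta>) a)"
      by (simp add: Gal_def)
    also have "\<dots> = ?s"
    proof (rule sum.reindex_bij_betw)
      show "bij_betw ((\<otimes>\<^bsub>Gal \<iota>\<^esub>) \<phi>) (carrier (Gal \<iota>)) (carrier (Gal \<iota>))"
        using \<phi> by (simp add: bij_betw_def G.inj_on_multc G.inj_on_cmult G.surj_const_mult)
    qed
    finally show ?thesis .
  qed
  then have "?s \<in> range \<iota>"
    using assms by (auto simp: finite_galois_def)
  then show ?thesis
    unfolding Tr_def by (rule f_the_inv_into_f[OF inj_embedding])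
qed

end

theory Submission
  imports Defs
begin

text \<open>
  Write \<open>\<sigma>\<^sup>j\<close> for the powers of the generator. Everything rests on one description of the bilinear
  forms on \<open>L\<close>: each is \<open>(x, y) \<mapsto> Tr (\<Sum>j<n. b\<^sub>j \<sigma>\<^sup>j(y) x)\<close> for exactly one family \<open>b\<close>. Existence
  comes from elements \<open>u\<^sub>r, v\<^sub>r\<close> with \<open>\<Sum>r. u\<^sub>r \<theta>(v\<^sub>r) = 0\<close> for \<open>\<theta> \<noteq> id\<close> and \<open>= 1\<close> for \<open>\<theta> = id\<close>
  (\<open>separating_tensor\<close>): they give \<open>x = \<Sum>r. Tr(v\<^sub>r x) u\<^sub>r\<close>, so that every linear map out of \<open>L\<close>
  can be written with traces (\<open>functional_eq_trace\<close>, \<open>endomorphism_eq_pow_sum\<close>). Uniqueness is the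
  linear independence of automorphisms.

  An alternating form \<open>f(x, y)\<close> is half of \<open>f(x, y) - f(y, x)\<close>, hence a sum of skew-forms attached
  to the powers \<open>\<sigma>\<^sup>j\<close>. The skew-forms for \<open>\<sigma>\<^sup>j\<close> and for \<open>\<sigma>\<^sup>n\<^sup>-\<^sup>j\<close> make up the same space and those
  for \<open>\<sigma>\<^sup>0\<close> vanish, so \<open>Alt\<close> is the sum of \<open>B\<^sup>1\<close> and the \<open>A\<^sup>i\<close> with \<open>1 \<le> i < k\<close>; the uniqueness of
  coefficients makes the sum direct, and every form in such an \<open>A\<^sup>i\<close> has a unique coefficient \<open>b \<in> L\<close>.

  It remains to split \<open>A\<^sup>i\<close> when \<open>\<tau> = \<sigma>\<^sup>i\<close> has even order, which forces \<open>i\<close> to be odd. Let \<open>M\<close> be the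
  fixed field of the involution \<open>\<sigma>\<^sup>k\<close>, of degree \<open>k\<close>, and let \<open>\<epsilon> \<noteq> 0\<close> satisfy \<open>\<sigma>(\<epsilon>) = -\<epsilon>\<close>. Then
  \<open>L = \<epsilon>M \<oplus> M\<close>, and \<open>\<U>\<^sub>i\<close>, \<open>\<V>\<^sub>i\<close> consist of the forms with \<open>b\<close> in \<open>\<epsilon>M\<close> and in \<open>M\<close>. The radical of
  the form with coefficient \<open>b\<close> is the solution space of \<open>b x = \<tau>(b) \<tau>\<^sup>2(x)\<close> (\<open>radical_sf\<close>). On \<open>M\<close> the
  automorphism \<open>\<tau>\<close> has odd order, so it is a power of \<open>\<tau>\<^sup>2\<close> there, and a telescoping product yields a
  nonzero solution \<open>x\<^sub>0\<close> for \<open>0 \<noteq> b \<in> M\<close> (\<open>radical_solution\<close>), an explicit instance of Hilbert's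
  Theorem 90. The radical is then \<open>x\<^sub>0\<close> times the fixed field of \<open>\<tau>\<^sup>2\<close>, whose degree is
  \<open>2n / ord \<tau>\<close>. For \<open>\<epsilon>b\<close> in place of \<open>b\<close> a sign enters: \<open>z = x / x\<^sub>0\<close> has to satisfy
  \<open>\<tau>\<^sup>2(z) = -z\<close>, which is impossible for \<open>z \<noteq> 0\<close> because \<open>\<tau>\<^sup>2\<close> to the odd power \<open>k\<close> is the identity.
\<close>

section \<open>Finite sums, linear systems and direct sums\<close>

lemma sum_fun_apply: "(\<Sum>a\<in>I. h a) x = (\<Sum>a\<in>I. h a x)"
  by (induction I rule: infinite_finite_induct) simp_all

lemma sum_lessThan_blocks:
  fixes f :: "nat \<Rightarrow> 'a::comm_monoid_add"
  shows "(\<Sum>j<d. \<Sum>i<e. f (j + d * i)) = (\<Sum>l<d * e. f l)"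
proof (induction e)
  case (Suc e)
  have split: "(\<Sum>l<m + d. f l) = (\<Sum>l<m. f l) + (\<Sum>j<d. f (j + m))" for m
    by (induction d) (simp_all add: add_ac)
  show ?case
    using Suc split[of "d * e"] by (simp add: sum.distrib add.commute)
qed simp

text \<open>
  The exponents modulo \<open>2k\<close> are grouped into the two that are their own negatives, \<open>0\<close> and \<open>k\<close>,
  and the pairs \<open>{i, 2k - i}\<close>.
\<close>

lemma sum_lessThan_double:
  fixes g :: "nat \<Rightarrow> 'a::comm_monoid_add"
  assumes "k \<ge> 1"
  shows "(\<Sum>j<2*k. g j) = g 0 + g k + (\<Sum>i\<in>{1..k-1}. g i + g (2*k - i))"
proof -
  have "{..<2*k} = insert 0 (insert k ({1..k-1} \<union> (\<lambda>i. 2*k - i) ` {1..k-1}))" (is "_ = ?R")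
  proof (intro equalityI subsetI)
    fix j assume j: "j \<in> {..<2*k}"
    show "j \<in> ?R"
    proof (cases "k < j")
      case True
      with j have "j = 2*k - (2*k - j)" "2*k - j \<in> {1..k-1}" by auto
      then have "j \<in> (\<lambda>i. 2*k - i) ` {1..k-1}" by (rule image_eqI)
      then show ?thesis by blast
    qed auto
  qed (use assms in auto)
  moreover have "(\<Sum>j\<in>(\<lambda>i. 2*k - i) ` {1..k-1}. g j) = (\<Sum>i\<in>{1..k-1}. g (2*k - i))"
    by (subst sum.reindex) (auto simp: inj_on_def)
  moreover have "(\<Sum>j\<in>{1..k-1} \<union> (\<lambda>i. 2*k - i) ` {1..k-1}. g j)
      = (\<Sum>j\<in>{1..k-1}. g j) + (\<Sum>j\<in>(\<lambda>i. 2*k - i) ` {1..k-1}. g j)"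
    by (rule sum.union_disjoint) auto
  moreover have "0 \<notin> insert k ({1..k-1} \<union> (\<lambda>i. 2*k - i) ` {1..k-1})"
    "k \<notin> {1..k-1} \<union> (\<lambda>i. 2*k - i) ` {1..k-1}"
    using assms by auto
  ultimately show ?thesis
    by (simp add: sum.distrib add.assoc)
qed

text \<open>
  A homogeneous system with more unknowns than equations has a nontrivial solution: each equation
  eliminates at most one unknown.
\<close>

lemma card_le_of_independent_rows:
  fixes v :: "'s \<Rightarrow> 't \<Rightarrow> 'f::field"
  assumes "finite T" "finite S"
    and "\<And>a. (\<forall>t\<in>T. (\<Sum>s\<in>S. a s * v s t) = 0) \<Longrightarrow> \<forall>s\<in>S. a s = 0"
  shows "card S \<le> card T"
  using assms
proof (induction T arbitrary: S v rule: finite_induct)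
  case empty
  have "\<forall>s\<in>S. (1::'f) = 0"
    by (rule empty(2)) simp
  then show ?case by auto
next
  case (insert t T)
  show ?case
  proof (cases "\<exists>s0\<in>S. v s0 t \<noteq> 0")
    case False
    have "card S \<le> card T"
    proof (rule insert.IH[OF insert.prems(1)])
      fix a assume "\<forall>t\<in>T. (\<Sum>s\<in>S. a s * v s t) = 0"
      moreover have "(\<Sum>s\<in>S. a s * v s t) = 0"
        using False by simp
      ultimately show "\<forall>s\<in>S. a s = 0"
        using insert.prems(2)[of a] by blast
    qed
    then show ?thesis using insert.hyps by simp
  next
    case True
    then obtain s0 where s0: "s0 \<in> S" "v s0 t \<noteq> 0" by blast
    define w where "w s u = v s u - v s t / v s0 t * v s0 u" for s u
    have "card (S - {s0}) \<le> card T"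
    proof (rule insert.IH)
      show "finite (S - {s0})" using insert.prems(1) by simp
      fix a assume a: "\<forall>u\<in>T. (\<Sum>s\<in>S - {s0}. a s * w s u) = 0"
      \<comment> \<open>chosen so that the equation for \<open>t\<close> holds after \<open>a\<close> is extended to \<open>s0\<close>\<close>
      define c where "c = - (\<Sum>s\<in>S - {s0}. a s * (v s t / v s0 t))"
      have split: "(\<Sum>s\<in>S. (a(s0 := c)) s * v s u) = (\<Sum>s\<in>S - {s0}. a s * w s u)" for u
      proof -
        have "(\<Sum>s\<in>S. (a(s0 := c)) s * v s u)
              = c * v s0 u + (\<Sum>s\<in>S - {s0}. a s * v s u)"
          using insert.prems(1) s0(1) by (simp add: sum.remove[of S s0])
        also have "\<dots> = (\<Sum>s\<in>S - {s0}. a s * w s u)"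
          by (simp add: c_def w_def right_diff_distrib sum_subtractf sum_distrib_right mult.assoc)
        finally show ?thesis .
      qed
      have "w s t = 0" for s
        using s0(2) by (simp add: w_def)
      then have "\<forall>u\<in>insert t T. (\<Sum>s\<in>S. (a(s0 := c)) s * v s u) = 0"
        using a by (simp only: split) simp
      then have "\<forall>s\<in>S. (a(s0 := c)) s = 0"
        by (rule insert.prems(2))
      then show "\<forall>s\<in>S - {s0}. a s = 0" by (metis DiffE fun_upd_other singletonI)
    qed
    then show ?thesis
      using insert.hyps insert.prems(1) s0(1) by (simp add: card_Diff_singleton)
  qed
qed

lemma internal_direct_sumI:
  fixes W :: "'i \<Rightarrow> 'v::ab_group_add set"
  assumes "finite I"
    and diff: "\<And>i x y. i \<in> I \<Longrightarrow> x \<in> W i \<Longrightarrow> y \<in> W i \<Longrightarrow> x - y \<in> W i"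
    and closed: "\<And>w. (\<And>i. i \<in> I \<Longrightarrow> w i \<in> W i) \<Longrightarrow> sum w I \<in> V"
    and trivial: "\<And>w. (\<And>i. i \<in> I \<Longrightarrow> w i \<in> W i) \<Longrightarrow> sum w I = 0 \<Longrightarrow> \<forall>i\<in>I. w i = 0"
    and spans: "\<And>v. v \<in> V \<Longrightarrow> \<exists>w. (\<forall>i\<in>I. w i \<in> W i) \<and> sum w I = v"
  shows "internal_direct_sum V I W"
  unfolding internal_direct_sum_def bij_betw_def
proof (intro conjI)
  show "inj_on (\<lambda>w. \<Sum>j\<in>I. w j) (Pi\<^sub>E I W)"
  proof (rule inj_onI)
    fix w w' assume w: "w \<in> Pi\<^sub>E I W" "w' \<in> Pi\<^sub>E I W" and eq: "(\<Sum>j\<in>I. w j) = (\<Sum>j\<in>I. w' j)"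
    have "\<forall>i\<in>I. w i - w' i = 0"
      using w eq by (intro trivial) (auto simp: sum_subtractf intro: diff)
    then show "w = w'"
      using w by (intro PiE_ext[of w I W w']) auto
  qed
  show "(\<lambda>w. \<Sum>j\<in>I. w j) ` Pi\<^sub>E I W = V"
  proof
    show "(\<lambda>w. \<Sum>j\<in>I. w j) ` Pi\<^sub>E I W \<subseteq> V"
      using closed by (auto dest: PiE_mem)
    show "V \<subseteq> (\<lambda>w. \<Sum>j\<in>I. w j) ` Pi\<^sub>E I W"
    proof
      fix v assume "v \<in> V"
      then obtain w where w: "\<forall>i\<in>I. w i \<in> W i" "sum w I = v"
        using spans by blast
      then have "restrict w I \<in> Pi\<^sub>E I W" "(\<Sum>j\<in>I. restrict w I j) = v"
        by (auto intro: sum.cong)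
      then show "v \<in> (\<lambda>w. \<Sum>j\<in>I. w j) ` Pi\<^sub>E I W" by blast
    qed
  qed
qed (fact assms(1))

section \<open>Independence of field automorphisms\<close>

text \<open>
  For \<open>\<phi> \<noteq> \<tau>\<close> choose \<open>z\<close> with \<open>\<tau> z \<noteq> \<phi> z\<close>. The function \<open>\<theta> \<mapsto> (\<theta> z - \<phi> z) / (\<tau> z - \<phi> z)\<close> has the
  form \<open>\<theta> \<mapsto> \<Sum> x * \<theta> y\<close>, vanishes at \<open>\<phi>\<close> and is \<open>1\<close> at \<open>\<tau>\<close>; functions of this form are closed under
  products, so the product over all \<open>\<phi> \<in> T\<close> is the required one. A list of pairs stands for a tensor
  in \<open>L \<otimes> L\<close>.
\<close>

lemma separating_tensor:
  fixes \<tau> :: "'l::field \<Rightarrow> 'l"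
  assumes "finite T" "\<tau> \<notin> T"
    and hom: "\<forall>\<theta>\<in>insert \<tau> T. \<theta> 1 = 1 \<and> (\<forall>x y. \<theta> (x * y) = \<theta> x * \<theta> y)"
  shows "\<exists>ps. (\<Sum>(x,y)\<leftarrow>ps. x * \<tau> y) = 1 \<and> (\<forall>\<theta>\<in>T. (\<Sum>(x,y)\<leftarrow>ps. x * \<theta> y) = 0)"
  using assms
proof (induction T rule: finite_induct)
  case empty
  show ?case
    by (rule exI[of _ "[(1, 1)]"]) (simp add: empty)
next
  case (insert \<phi> T)
  obtain ps where ps: "(\<Sum>(x,y)\<leftarrow>ps. x * \<tau> y) = 1" "\<forall>\<theta>\<in>T. (\<Sum>(x,y)\<leftarrow>ps. x * \<theta> y) = 0"
    using insert by auto
  obtain z where z: "\<tau> z \<noteq> \<phi> z"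
    using insert.prems(1) by (metis ext insertI1)
  define a where "a = 1 / (\<tau> z - \<phi> z)"
  define qs where "qs = map (\<lambda>(x,y). (a * x, y * z)) ps @ map (\<lambda>(x,y). (- (a * \<phi> z) * x, y)) ps"
  have qs: "(\<Sum>(x,y)\<leftarrow>qs. x * \<theta> y) = (\<Sum>(x,y)\<leftarrow>ps. x * \<theta> y) * (a * (\<theta> z - \<phi> z))"
    if "\<theta> \<in> insert \<tau> (insert \<phi> T)" for \<theta>
  proof -
    have m: "\<theta> (x * y) = \<theta> x * \<theta> y" for x y
      using insert.prems(2) that by blast
    show ?thesis unfolding qs_def
      by (induction ps) (auto simp: m algebra_simps)
  qed
  show ?case
    using z ps by (intro exI[of _ qs]) (auto simp: qs a_def)
qed

text \<open>
  Dedekind's lemma. Applying the relation to the second components of a tensor that separates \<open>\<tau>\<close>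
  from the other maps isolates the coefficient of \<open>\<tau>\<close>.
\<close>

lemma automorphisms_independent:
  fixes S :: "('l::field \<Rightarrow> 'l) set"
  assumes S: "finite S"
    and hom: "\<forall>\<theta>\<in>S. \<theta> 1 = 1 \<and> (\<forall>x y. \<theta> (x * y) = \<theta> x * \<theta> y)"
    and zero: "\<And>y. (\<Sum>\<theta>\<in>S. a \<theta> * \<theta> y) = 0"
    and \<tau>: "\<tau> \<in> S"
  shows "a \<tau> = 0"
proof -
  obtain ps where ps: "(\<Sum>(x,y)\<leftarrow>ps. x * \<tau> y) = 1" "\<forall>\<theta>\<in>S - {\<tau>}. (\<Sum>(x,y)\<leftarrow>ps. x * \<theta> y) = 0"
    using separating_tensor[of "S - {\<tau>}" \<tau>] S hom \<tau> by auto
  have "a \<tau> = (\<Sum>\<theta>\<in>S. a \<theta> * (\<Sum>(x,y)\<leftarrow>ps. x * \<theta> y))"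
    using S \<tau> ps by (simp add: sum.remove[of S \<tau>])
  also have "\<dots> = (\<Sum>(x,y)\<leftarrow>ps. x * (\<Sum>\<theta>\<in>S. a \<theta> * \<theta> y))"
    by (induction ps) (auto simp: sum.distrib sum_distrib_left algebra_simps)
  also have "\<dots> = 0"
    by (simp add: zero case_prod_unfold)
  finally show ?thesis .
qed

section \<open>Cyclic Galois extensions\<close>

locale cyclic_galois = field_extension \<iota> for \<iota> :: "'k::field \<Rightarrow> 'l::field" +
  fixes \<sigma> :: "'l \<Rightarrow> 'l"
  assumes galois: "finite_galois \<iota>"
    and generator: "\<sigma> \<in> carrier (Gal \<iota>)" "carrier (Gal \<iota>) = generate (Gal \<iota>) {\<sigma>}"
begin

sublocale G: group "Gal \<iota>" by (rule group_Gal)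

sublocale L: vector_space "ext_scale \<iota>" by (rule vector_space_ext_scale)

lemma embed_0 [simp]: "\<iota> 0 = 0"
proof -
  have "\<iota> 0 + \<iota> 0 = \<iota> 0 + 0" by (simp flip: hom_add)
  then show ?thesis by (simp only: add_left_cancel)
qed

lemma embed_eq_iff [simp]: "\<iota> a = \<iota> b \<longleftrightarrow> a = b"
  using inj_embedding by (simp add: inj_eq)

lemma pow_Gal: "\<sigma> [^]\<^bsub>Gal \<iota>\<^esub> j = \<sigma> ^^ j"
  by (induction j) (simp_all add: Gal_def nat_pow_def funpow_Suc_right del: funpow.simps(2))

lemma pow_in_Gal: "\<sigma> ^^ j \<in> carrier (Gal \<iota>)"
  using G.nat_pow_closed[OF generator(1), of j] by (simp add: pow_Gal)

lemma
  shows pow_add [simp]: "(\<sigma> ^^ j) (x + y) = (\<sigma> ^^ j) x + (\<sigma> ^^ j) y"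
    and pow_mult [simp]: "(\<sigma> ^^ j) (x * y) = (\<sigma> ^^ j) x * (\<sigma> ^^ j) y"
    and pow_embed [simp]: "(\<sigma> ^^ j) (\<iota> c) = \<iota> c"
    and bij_pow: "bij (\<sigma> ^^ j)"
  using pow_in_Gal[of j] by (simp_all add: Gal_def)

lemma pow_0 [simp]: "(\<sigma> ^^ j) 0 = 0"
  using pow_embed[of j 0] by simp

lemma pow_1 [simp]: "(\<sigma> ^^ j) 1 = 1"
  using pow_embed[of j 1] by (simp add: hom_one)

lemma pow_minus [simp]: "(\<sigma> ^^ j) (- x) = - (\<sigma> ^^ j) x"
  using pow_add[of j x "- x"] by (simp del: pow_add add: eq_neg_iff_add_eq_0 add.commute)

lemma pow_diff [simp]: "(\<sigma> ^^ j) (x - y) = (\<sigma> ^^ j) x - (\<sigma> ^^ j) y"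
  using pow_add[of j x "- y"] by simp

lemma pow_sum [simp]: "(\<sigma> ^^ j) (\<Sum>x\<in>I. h x) = (\<Sum>x\<in>I. (\<sigma> ^^ j) (h x))"
  by (induction I rule: infinite_finite_induct) simp_all

lemma pow_eq_0_iff [simp]: "(\<sigma> ^^ j) x = 0 \<longleftrightarrow> x = 0"
  using bij_pow[of j] pow_0[of j] by (metis bij_is_inj injD)

lemma pow_inverse [simp]: "(\<sigma> ^^ j) (inverse x) = inverse ((\<sigma> ^^ j) x)"
proof (cases "x = 0")
  case False
  then have "(\<sigma> ^^ j) x * (\<sigma> ^^ j) (inverse x) = 1"
    by (simp flip: pow_mult)
  then show ?thesis by (metis inverse_unique)
qed simp

lemma pow_divide [simp]: "(\<sigma> ^^ j) (x / y) = (\<sigma> ^^ j) x / (\<sigma> ^^ j) y"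
  by (simp add: divide_inverse)

lemma pow_prod [simp]: "(\<sigma> ^^ j) (\<Prod>x\<in>I. h x) = (\<Prod>x\<in>I. (\<sigma> ^^ j) (h x))"
  by (induction I rule: infinite_finite_induct) simp_all

lemma pow_pow: "(\<sigma> ^^ i) ((\<sigma> ^^ j) x) = (\<sigma> ^^ (i + j)) x"
  by (simp add: funpow_add)

abbreviation N :: nat where "N \<equiv> group.ord (Gal \<iota>) \<sigma>"

lemma pow_eq_id_iff: "\<sigma> ^^ j = id \<longleftrightarrow> N dvd j"
  using G.pow_eq_id[OF generator(1), of j] by (simp add: pow_Gal) (simp add: Gal_def)

lemma pow_N [simp]: "(\<sigma> ^^ N) x = x"
  using pow_eq_id_iff[of N] by simp

text \<open>
  The case \<open>N = 0\<close> is the convention for a generator of infinite order; it serves to rule that case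
  out in \<open>N_pos\<close>.
\<close>

lemma pow_inj:
  assumes "N = 0 \<or> d \<le> N"
  shows "inj_on (\<lambda>j. \<sigma> ^^ j) {..<d}"
proof -
  have "i = j" if eq: "\<sigma> ^^ i = \<sigma> ^^ j" and "i \<le> j" "j < d" for i j
  proof -
    have "(\<sigma> ^^ i) ((\<sigma> ^^ (j - i)) x) = (\<sigma> ^^ i) x" for x
      using \<open>i \<le> j\<close> by (subst eq) (simp add: pow_pow)
    then have "\<sigma> ^^ (j - i) = id"
      using bij_pow[of i] by (metis bij_is_inj injD eq_id_iff)
    then have "N dvd j - i"
      by (simp only: pow_eq_id_iff)
    with that assms show "i = j"
      by (metis diff_is_0_eq dvd_0_left_iff le_antisym less_imp_diff_less linorder_not_less
          nat_dvd_not_less neq0_conv order_less_le_trans)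
  qed
  then show ?thesis
    unfolding inj_on_def by (metis lessThan_iff nat_le_linear)
qed

lemma pow_independent:
  assumes d: "N = 0 \<or> d \<le> N" and zero: "\<And>y. (\<Sum>j<d. a j * (\<sigma> ^^ j) y) = 0" and "i < d"
  shows "a i = 0"
proof -
  let ?S = "(\<lambda>j. \<sigma> ^^ j) ` {..<d}"
  let ?i = "the_inv_into {..<d} (\<lambda>j. \<sigma> ^^ j)"
  note inj = pow_inj[OF d]
  have idx: "?i (\<sigma> ^^ j) = j" if "j < d" for j
    using the_inv_into_f_f[OF inj, of j] that by simp
  have "a (?i (\<sigma> ^^ i)) = 0"
  proof (rule automorphisms_independent[where S = ?S and a = "\<lambda>\<theta>. a (?i \<theta>)"])
    show "(\<Sum>\<theta>\<in>?S. a (?i \<theta>) * \<theta> y) = 0" for y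
      using zero[of y] by (simp add: sum.reindex[OF inj] idx)
  qed (use \<open>i < d\<close> in auto)
  then show ?thesis using idx[OF \<open>i < d\<close>] by simp
qed

lemma finite_basis:
  obtains B where "B \<subseteq> F" "finite B" "L.independent B" "F \<subseteq> L.span B" "card B = L.dim F"
proof -
  obtain B0 where "finite B0" "L.span B0 = UNIV"
    using galois by (auto simp: finite_galois_def)
  then show ?thesis
    using L.basis_exists[of F] L.independent_span_bound that by (metis subset_UNIV)
qed

text \<open>
  Powers that are independent on \<open>F\<close> are independent as vectors of values on a basis of
  \<open>F\<close>, so there are at most as many of them as basis elements.
\<close>

lemma le_dim_of_independent_pow:
  assumes indep: "\<And>a. (\<And>y. y \<in> F \<Longrightarrow> (\<Sum>j<d. a j * (\<sigma> ^^ j) y) = 0) \<Longrightarrow> \<forall>j<d. a j = 0"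
  shows "d \<le> L.dim F"
proof -
  obtain B where B: "finite B" "F \<subseteq> L.span B" "card B = L.dim F"
    by (rule finite_basis)
  have "card {..<d} \<le> card B"
  proof (rule card_le_of_independent_rows[where v = "\<lambda>j b. (\<sigma> ^^ j) b"])
    fix a assume a: "\<forall>b\<in>B. (\<Sum>j\<in>{..<d}. a j * (\<sigma> ^^ j) b) = 0"
    have "(\<Sum>j<d. a j * (\<sigma> ^^ j) y) = 0" if "y \<in> L.span B" for y
      using that
    proof (induction rule: L.span_induct_alt)
      case (step c x y)
      have "(\<Sum>j<d. a j * (\<sigma> ^^ j) (ext_scale \<iota> c x + y))
            = \<iota> c * (\<Sum>j<d. a j * (\<sigma> ^^ j) x) + (\<Sum>j<d. a j * (\<sigma> ^^ j) y)"
        by (simp add: ext_scale_def sum.distrib sum_distrib_left algebra_simps)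
      then show ?case using a step by simp
    qed simp
    then show "\<forall>j\<in>{..<d}. a j = 0"
      using indep[of a] B(2) by auto
  qed (use B in auto)
  then show ?thesis using B by simp
qed

lemma N_pos [simp]: "0 < N"
proof (rule ccontr)
  assume "\<not> 0 < N"
  then have N: "N = 0 \<or> d \<le> N" for d by blast
  have "Suc (L.dim UNIV) \<le> L.dim UNIV"
  proof (rule le_dim_of_independent_pow)
    fix a assume "\<And>y. y \<in> UNIV \<Longrightarrow> (\<Sum>j<Suc (L.dim UNIV). a j * (\<sigma> ^^ j) y) = 0"
    then show "\<forall>j<Suc (L.dim UNIV). a j = 0"
      using pow_independent[OF N] by blast
  qed
  then show False by simp
qed

lemma carrier_eq: "carrier (Gal \<iota>) = (\<lambda>j. \<sigma> ^^ j) ` {..<N}"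
proof -
  have "carrier (Gal \<iota>) = {\<sigma> ^^ j | j. True}"
    using G.generate_pow_nat[OF generator(1)] N_pos generator(2) by (auto simp: pow_Gal)
  moreover have "\<sigma> ^^ j \<in> (\<lambda>j. \<sigma> ^^ j) ` {..<N}" for j
  proof (rule image_eqI)
    show "\<sigma> ^^ j = \<sigma> ^^ (j mod N)"
      by (rule ext) (simp add: funpow_mod_eq)
  qed simp
  ultimately show ?thesis by auto
qed

lemma inj_pow: "inj_on (\<lambda>j. \<sigma> ^^ j) {..<N}"
  by (rule pow_inj) simp

lemma embed_Tr_pow: "\<iota> (Tr \<iota> x) = (\<Sum>j<N. (\<sigma> ^^ j) x)"
  using embed_Tr[OF galois, of x] sum.reindex[OF inj_pow] by (simp add: carrier_eq)

lemma Tr_add: "Tr \<iota> (x + y) = Tr \<iota> x + Tr \<iota> y"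
  unfolding embed_eq_iff[symmetric] hom_add by (simp add: embed_Tr_pow sum.distrib)

lemma Tr_scale: "Tr \<iota> (\<iota> c * x) = c * Tr \<iota> x"
  unfolding embed_eq_iff[symmetric] hom_mult by (simp add: embed_Tr_pow sum_distrib_left)

lemma Tr_0 [simp]: "Tr \<iota> 0 = 0"
  using Tr_scale[of 0 0] by simp

lemma Tr_minus: "Tr \<iota> (- x) = - Tr \<iota> x"
  using Tr_add[of x "- x"] by (simp add: eq_neg_iff_add_eq_0 add.commute)

lemma Tr_diff: "Tr \<iota> (x - y) = Tr \<iota> x - Tr \<iota> y"
  using Tr_add[of x "- y"] by (simp add: Tr_minus)

lemma Tr_sum: "Tr \<iota> (\<Sum>x\<in>I. h x) = (\<Sum>x\<in>I. Tr \<iota> (h x))"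
  by (induction I rule: infinite_finite_induct) (simp_all add: Tr_add)

lemma sum_pow_shift: "(\<Sum>i<e. (\<sigma> ^^ (d * Suc i)) x) = (\<Sum>i<e. (\<sigma> ^^ (d * i)) x)"
  if "d * e = N"
proof -
  have "(\<Sum>i<Suc e. (\<sigma> ^^ (d * i)) x) = x + (\<Sum>i<e. (\<sigma> ^^ (d * Suc i)) x)"
    by (simp only: sum.lessThan_Suc_shift) simp
  moreover have "(\<Sum>i<Suc e. (\<sigma> ^^ (d * i)) x) = (\<Sum>i<e. (\<sigma> ^^ (d * i)) x) + x"
    using that by simp
  ultimately show ?thesis by simp
qed

lemma Tr_pow [simp]: "Tr \<iota> ((\<sigma> ^^ j) x) = Tr \<iota> x"
proof (induction j)
  case (Suc j)
  have "\<iota> (Tr \<iota> (\<sigma> y)) = \<iota> (Tr \<iota> y)" for y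
    using sum_pow_shift[of 1 N y] by (simp only: embed_Tr_pow funpow_swap1[symmetric]) simp
  then show ?case using Suc by simp
qed simp

lemma trace_form_nondegenerate:
  assumes "\<And>y. Tr \<iota> (c * y) = 0"
  shows "c = 0"
proof -
  have "(\<Sum>j<N. (\<sigma> ^^ j) c * (\<sigma> ^^ j) y) = 0" for y
    using embed_Tr_pow[of "c * y"] assms by simp
  then have "(\<sigma> ^^ 0) c = 0"
    by (rule pow_independent[where d = N, rotated]) simp_all
  then show ?thesis by simp
qed

text \<open>
  A tensor separating the identity from the rest of the group turns into a pair of dual generating
  systems for the trace form, since \<open>\<Sum>(u,v). Tr (v x) u = \<Sum>\<theta>. \<theta> x (\<Sum>(u,v). u \<theta> v)\<close>.
\<close>

lemma trace_coordinates:
  obtains ps where "\<And>x. (\<Sum>(u,v)\<leftarrow>ps. \<iota> (Tr \<iota> (v * x)) * u) = x"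
proof -
  let ?T = "(\<lambda>j. \<sigma> ^^ j) ` {..<N} - {id}"
  obtain ps where ps: "(\<Sum>(u,v)\<leftarrow>ps. u * id v) = 1" "\<forall>\<theta>\<in>?T. (\<Sum>(u,v)\<leftarrow>ps. u * \<theta> v) = 0"
    using separating_tensor[of ?T id] by auto
  have delta: "(\<Sum>(u,v)\<leftarrow>ps. u * (\<sigma> ^^ j) v) = (if j = 0 then 1 else 0)" if "j < N" for j
  proof (cases "j = 0")
    case False
    then have "\<sigma> ^^ j \<noteq> id"
      using that by (simp add: pow_eq_id_iff nat_dvd_not_less)
    then show ?thesis using ps(2) that False by auto
  qed (use ps(1) in simp)
  have 1: "x = (\<Sum>(u,v)\<leftarrow>ps. (\<Sum>j<N. (\<sigma> ^^ j) v * (\<sigma> ^^ j) x) * u)" for x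
  proof -
    have "(\<Sum>(u,v)\<leftarrow>ps. (\<Sum>j<N. (\<sigma> ^^ j) v * (\<sigma> ^^ j) x) * u)
        = (\<Sum>j<N. (\<sigma> ^^ j) x * (\<Sum>(u,v)\<leftarrow>ps. u * (\<sigma> ^^ j) v))"
      by (induction ps) (auto simp: sum.distrib sum_distrib_left sum_distrib_right algebra_simps)
    also have "\<dots> = (\<Sum>j<N. if j = 0 then x else 0)"
      by (intro sum.cong) (auto simp: delta)
    also have "\<dots> = x" by simp
    finally show ?thesis by simp
  qed
  show ?thesis
    by (rule that[of ps]) (simp only: embed_Tr_pow pow_mult 1[symmetric])
qed

text \<open>
  Applying \<open>g\<close> to the trace expansion of \<open>x\<close> exhibits \<open>c = \<Sum>(u,v). g(u) v\<close>.
\<close>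

lemma functional_eq_trace:
  assumes "Vector_Spaces.linear (ext_scale \<iota>) (*) g"
  shows "\<exists>c. \<forall>x. g x = Tr \<iota> (c * x)"
proof -
  interpret g: Vector_Spaces.linear "ext_scale \<iota>" "(*)" g by fact
  obtain ps where ps: "\<And>x. (\<Sum>(u,v)\<leftarrow>ps. \<iota> (Tr \<iota> (v * x)) * u) = x"
    by (rule trace_coordinates) blast
  have scale: "g (\<iota> c * x) = g x * c" for c x
    using g.scale[of c x] by (simp add: ext_scale_def mult.commute)
  have "g (\<Sum>(u,v)\<leftarrow>qs. \<iota> (Tr \<iota> (v * x)) * u) = Tr \<iota> ((\<Sum>(u,v)\<leftarrow>qs. \<iota> (g u) * v) * x)" for qs x
    by (induction qs)
      (auto simp: g.zero g.add scale Tr_add distrib_right mult.assoc Tr_scale)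
  from this[where qs = ps] have "g x = Tr \<iota> ((\<Sum>(u,v)\<leftarrow>ps. \<iota> (g u) * v) * x)" for x
    unfolding ps .
  then show ?thesis by blast
qed

text \<open>
  Applying \<open>\<phi>\<close> to the trace expansion and writing out the traces collects the coefficient
  \<open>\<Sum>(u,v). \<phi>(u) \<sigma>\<^sup>j(v)\<close> of \<open>\<sigma>\<^sup>j\<close>.
\<close>

lemma endomorphism_eq_pow_sum:
  assumes add: "\<And>x y. \<phi> (x + y) = \<phi> x + \<phi> y" and scale: "\<And>c x. \<phi> (\<iota> c * x) = \<iota> c * \<phi> x"
  shows "\<exists>b. \<forall>y. \<phi> y = (\<Sum>j<N. b j * (\<sigma> ^^ j) y)"
proof -
  obtain ps where ps: "\<And>x. (\<Sum>(u,v)\<leftarrow>ps. \<iota> (Tr \<iota> (v * x)) * u) = x"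
    by (rule trace_coordinates) blast
  have zero: "\<phi> 0 = 0" using scale[of 0 0] by simp
  have expand: "\<iota> (Tr \<iota> (v * x)) * w = (\<Sum>j<N. w * (\<sigma> ^^ j) v * (\<sigma> ^^ j) x)" for v x w
    by (simp add: embed_Tr_pow sum_distrib_left mult_ac)
  have "\<phi> (\<Sum>(u,v)\<leftarrow>qs. \<iota> (Tr \<iota> (v * x)) * u)
      = (\<Sum>j<N. (\<Sum>(u,v)\<leftarrow>qs. \<phi> u * (\<sigma> ^^ j) v) * (\<sigma> ^^ j) x)" for qs x
    by (induction qs) (auto simp: zero add scale expand[where w = "\<phi> u" for u] sum.distrib distrib_right)
  from this[where qs = ps] have "\<phi> x = (\<Sum>j<N. (\<Sum>(u,v)\<leftarrow>ps. \<phi> u * (\<sigma> ^^ j) v) * (\<sigma> ^^ j) x)" for x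
    unfolding ps .
  then show ?thesis by (intro exI allI)
qed

section \<open>Degrees of the intermediate fields\<close>

definition Fix :: "nat \<Rightarrow> 'l set" where
  "Fix d = {x. (\<sigma> ^^ d) x = x}"

lemma subspace_Fix: "L.subspace (Fix d)"
  by (rule L.subspaceI) (auto simp: Fix_def ext_scale_def)

lemma Fix_mod: "x \<in> Fix d \<Longrightarrow> (\<sigma> ^^ (l mod d)) x = (\<sigma> ^^ l) x"
  unfolding Fix_def by (rule funpow_mod_eq) simp

lemma Fix_mult:
  assumes "x \<in> Fix d"
  shows "(\<sigma> ^^ (d * l)) x = x"
  using Fix_mod[OF assms, of "d * l"] by simp

text \<open>
  Extend a basis of the fixed field to \<open>L\<close> and write its coordinate functionals as \<open>Tr (c _)\<close>. On
  the fixed field only the exponents modulo \<open>d\<close> matter, so the coordinate functionals express a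
  linear relation between the \<open>d\<close>-tuples \<open>(\<sigma>\<^sup>j b)\<^sub>j\<^sub><\<^sub>d\<close> as a relation between scalars.
\<close>

lemma dim_Fix_le:
  assumes "0 < d"
  shows "L.dim (Fix d) \<le> d"
proof -
  obtain B where B: "B \<subseteq> Fix d" "finite B" "L.independent B" "card B = L.dim (Fix d)"
    by (rule finite_basis)
  have "card B \<le> card {..<d}"
  proof (rule card_le_of_independent_rows[where v = "\<lambda>b j. (\<sigma> ^^ j) b"])
    fix a assume a: "\<forall>j\<in>{..<d}. (\<Sum>b\<in>B. a b * (\<sigma> ^^ j) b) = 0"
    show "\<forall>b\<in>B. a b = 0"
    proof
      fix b0 assume b0: "b0 \<in> B"
      let ?E = "L.extend_basis B"
      have E: "L.independent ?E" "L.span ?E = UNIV" "B \<subseteq> ?E"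
        using L.independent_extend_basis[OF B(3)] L.span_extend_basis[OF B(3)]
          L.extend_basis_superset[OF B(3)] by auto
      obtain c where c: "\<And>x. L.representation ?E x b0 = Tr \<iota> (c * x)"
        using functional_eq_trace[OF L.linear_representation[OF E(1,2), of b0]] by blast
      have Tr_c: "Tr \<iota> (c * b) = (if b = b0 then 1 else 0)" if "b \<in> B" for b
        using L.representation_basis[OF E(1), of b] that E(3) c[of b] by auto
      have "a b0 = (\<Sum>b\<in>B. a b * \<iota> (Tr \<iota> (c * b)))"
        using B(2) b0 by (simp add: Tr_c if_distrib hom_one cong: if_cong sum.cong)
      also have "\<dots> = (\<Sum>l<N. (\<sigma> ^^ l) c * (\<Sum>b\<in>B. a b * (\<sigma> ^^ l) b))"
        unfolding embed_Tr_pow sum_distrib_left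
        by (subst sum.swap) (simp add: algebra_simps)
      also have "\<dots> = (\<Sum>l<N. (\<sigma> ^^ l) c * (\<Sum>b\<in>B. a b * (\<sigma> ^^ (l mod d)) b))"
        using B(1) by (intro sum.cong arg_cong2[of _ _ _ _ "(*)"]) (auto simp: Fix_mod)
      also have "\<dots> = 0"
        using a assms by simp
      finally show "a b0 = 0" .
    qed
  qed (use B in auto)
  then show ?thesis using B by simp
qed

text \<open>
  For the lower bound, a relation between \<open>\<sigma>\<^sup>0, \<dots>, \<sigma>\<^sup>d\<^sup>-\<^sup>1\<close> on the fixed field is composed with the
  relative trace \<open>\<Sum>i<e. \<sigma>\<^sup>d\<^sup>i\<close> onto it; this gives a relation between all \<open>N\<close> powers on \<open>L\<close>.
\<close>

lemma dim_Fix: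
  assumes "d dvd N"
  shows "L.dim (Fix d) = d"
proof (rule antisym)
  obtain e where e: "N = d * e" using assms by blast
  with N_pos have "0 < d" "0 < e" by (auto intro!: gr0I)
  show "L.dim (Fix d) \<le> d" using \<open>0 < d\<close> by (rule dim_Fix_le)
  show "d \<le> L.dim (Fix d)"
  proof (rule le_dim_of_independent_pow)
    fix a assume a: "\<And>y. y \<in> Fix d \<Longrightarrow> (\<Sum>j<d. a j * (\<sigma> ^^ j) y) = 0"
    have "(\<Sum>l<N. a (l mod d) * (\<sigma> ^^ l) x) = 0" for x
    proof -
      have "(\<Sum>i<e. (\<sigma> ^^ (d * i)) x) \<in> Fix d"
        using sum_pow_shift[of d e x] e by (simp add: Fix_def pow_pow)
      from a[OF this] have "(\<Sum>j<d. \<Sum>i<e. a ((j + d * i) mod d) * (\<sigma> ^^ (j + d * i)) x) = 0"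
        by (simp add: pow_pow sum_distrib_left)
      then show ?thesis
        unfolding sum_lessThan_blocks[of "\<lambda>l. a (l mod d) * (\<sigma> ^^ l) x"] e .
    qed
    then have "a (l mod d) = 0" if "l < N" for l
      using pow_independent[where d = N and a = "\<lambda>l. a (l mod d)"] that by auto
    moreover have "d \<le> N" using e \<open>0 < e\<close> by simp
    ultimately show "\<forall>j<d. a j = 0" by (metis mod_less order_less_le_trans)
  qed
qed

lemma degree_eq: "degree_ext \<iota> = N"
proof -
  have "Fix N = UNIV" by (simp add: Fix_def)
  then show ?thesis using dim_Fix[of N] by (simp add: degree_ext_def)
qed

section \<open>Skew-forms attached to powers of the generator\<close>

sublocale F: vector_space "form_scale :: 'k \<Rightarrow> ('l \<Rightarrow> 'l \<Rightarrow> 'k) \<Rightarrow> 'l \<Rightarrow> 'l \<Rightarrow> 'k"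
  by (rule vector_space_form_scale)

abbreviation sf :: "nat \<Rightarrow> 'l \<Rightarrow> 'l \<Rightarrow> 'l \<Rightarrow> 'k" where
  "sf i b \<equiv> skew_form \<iota> b (\<sigma> ^^ i)"

lemma linear_form_iff: "Vector_Spaces.linear (ext_scale \<iota>) ((*) :: 'k \<Rightarrow> 'k \<Rightarrow> 'k) g
    \<longleftrightarrow> (\<forall>x y. g (x + y) = g x + g y) \<and> (\<forall>c x. g (\<iota> c * x) = c * g x)"
proof -
  have "vector_space ((*) :: 'k \<Rightarrow> 'k \<Rightarrow> 'k)"
    by unfold_locales (simp_all add: algebra_simps)
  then show ?thesis
    using L.vector_space_axioms by (simp add: Vector_Spaces.linear_iff ext_scale_def)
qed

lemma sf_in_Alt: "sf i b \<in> Alt \<iota>"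
  unfolding Alt_def skew_form_def linear_form_iff
  by (auto simp flip: Tr_add Tr_scale) (simp_all add: algebra_simps)

lemma linear_sf: "Vector_Spaces.linear (ext_scale \<iota>) form_scale (sf i)"
  unfolding Vector_Spaces.linear_iff
  by (auto simp: L.vector_space_axioms F.vector_space_axioms skew_form_def form_scale_def
      ext_scale_def fun_eq_iff Tr_add distrib_right mult.assoc Tr_scale)

sublocale sf: Vector_Spaces.linear "ext_scale \<iota>" form_scale "sf i" for i
  by (rule linear_sf)

lemma sf_scale: "sf i (\<iota> c * b) x y = c * sf i b x y"
  by (simp add: skew_form_def mult.assoc Tr_scale)

lemma range_sf: "A_space \<iota> (\<sigma> ^^ i) = range (sf i)"
  by (auto simp: A_space_def)

text \<open>
  Moving \<open>\<sigma>\<^sup>i\<close> off \<open>x\<close> under the trace shows the two coefficients of the form: \<open>b\<close> at \<open>\<sigma>\<^sup>i\<close> and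
  \<open>-\<sigma>\<^sup>-\<^sup>i(b)\<close> at \<open>\<sigma>\<^sup>-\<^sup>i\<close>.
\<close>

lemma sf_eq_Tr:
  assumes "i \<le> N"
  shows "sf i b x y = Tr \<iota> ((b * (\<sigma> ^^ i) y - (\<sigma> ^^ (N - i)) b * (\<sigma> ^^ (N - i)) y) * x)"
proof -
  have "Tr \<iota> (b * (\<sigma> ^^ i) x * y) = Tr \<iota> ((\<sigma> ^^ (N - i)) (b * (\<sigma> ^^ i) x * y))"
    by (rule Tr_pow[symmetric])
  also have "\<dots> = Tr \<iota> ((\<sigma> ^^ (N - i)) b * (\<sigma> ^^ (N - i)) y * x)"
    using assms by (simp add: pow_pow algebra_simps)
  finally show ?thesis
    by (simp add: skew_form_def Tr_diff algebra_simps)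
qed

lemma sf_inverse:
  assumes "i \<le> N"
  shows "sf (N - i) b = sf i (- (\<sigma> ^^ i) b)"
proof (intro ext)
  fix x y
  have "sf (N - i) b x y
      = Tr \<iota> ((\<sigma> ^^ i) (b * (x * (\<sigma> ^^ (N - i)) y - (\<sigma> ^^ (N - i)) x * y)))"
    by (simp only: Tr_pow skew_form_def)
  also have "\<dots> = sf i (- (\<sigma> ^^ i) b) x y"
    using assms by (simp add: pow_pow skew_form_def algebra_simps)
  finally show "sf (N - i) b x y = sf i (- (\<sigma> ^^ i) b) x y" .
qed

text \<open>
  Under the trace, \<open>b \<sigma>\<^sup>i(x) y\<close> may be replaced by its image under \<open>\<sigma>\<^sup>i\<close>; then \<open>\<sigma>\<^sup>i(y)\<close> runs through
  \<open>L\<close> and the trace form is nondegenerate.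
\<close>

lemma radical_sf: "x \<in> radical (sf i b) \<longleftrightarrow> b * x = (\<sigma> ^^ i) b * (\<sigma> ^^ (2 * i)) x"
proof -
  define d where "d = b * x - (\<sigma> ^^ i) b * (\<sigma> ^^ (2 * i)) x"
  have eq: "sf i b x y = Tr \<iota> (d * (\<sigma> ^^ i) y)" for y
  proof -
    have "Tr \<iota> (b * (\<sigma> ^^ i) x * y) = Tr \<iota> ((\<sigma> ^^ i) (b * (\<sigma> ^^ i) x * y))"
      by (rule Tr_pow[symmetric])
    then show ?thesis
      unfolding skew_form_def d_def mult_2 by (simp add: Tr_diff pow_pow algebra_simps)
  qed
  have "x \<in> radical (sf i b) \<longleftrightarrow> (\<forall>y. Tr \<iota> (d * (\<sigma> ^^ i) y) = 0)"
    by (simp add: radical_def eq)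
  also have "\<dots> \<longleftrightarrow> (\<forall>z. Tr \<iota> (d * z) = 0)"
    using bij_pow[of i] by (metis bij_is_surj surjD)
  also have "\<dots> \<longleftrightarrow> d = 0"
    using trace_form_nondegenerate by auto
  finally show ?thesis by (simp add: d_def)
qed

lemma dim_image_eq:
  assumes "Vector_Spaces.linear (ext_scale \<iota>) s f" "inj f"
  shows "vector_space.dim s (f ` S) = L.dim S"
proof -
  interpret f: Vector_Spaces.linear "ext_scale \<iota>" s f by fact
  obtain B where "finite B" "L.independent B" "UNIV \<subseteq> L.span B"
    by (rule finite_basis)
  then interpret finite_dimensional_vector_space_pair_1 "ext_scale \<iota>" B s
    by unfold_locales auto
  show ?thesis
    using assms by (intro dim_image_eq) (auto intro: inj_on_subset)
qed

lemma linear_mult: "Vector_Spaces.linear (ext_scale \<iota>) (ext_scale \<iota>) ((*) a)"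
  unfolding Vector_Spaces.linear_iff
  by (auto simp: L.vector_space_axioms ext_scale_def algebra_simps)

lemma Fix_gcd:
  assumes "0 < d"
  shows "Fix d = Fix (gcd d N)"
proof (intro equalityI subsetI)
  fix z assume z: "z \<in> Fix d"
  obtain u v where uv: "d * u = N * v + gcd d N"
    using bezout_nat[of d N] assms by auto
  have "(\<sigma> ^^ gcd d N) z = (\<sigma> ^^ (gcd d N)) ((\<sigma> ^^ (N * v)) z)"
    by (simp add: Fix_mult Fix_def)
  also have "\<dots> = (\<sigma> ^^ (d * u)) z"
    by (simp add: pow_pow uv add.commute)
  also have "\<dots> = z"
    using Fix_mult[OF z] .
  finally show "z \<in> Fix (gcd d N)" by (simp add: Fix_def)
next
  fix z assume z: "z \<in> Fix (gcd d N)"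
  have "d = gcd d N * (d div gcd d N)" by simp
  then show "z \<in> Fix d"
    using Fix_mult[OF z, of "d div gcd d N"] by (simp add: Fix_def)
qed

end

section \<open>Alternating forms on a cyclic extension of degree twice an odd number\<close>

locale cyclic_galois_twice_odd = cyclic_galois \<iota> \<sigma>
  for \<iota> :: "'k::field \<Rightarrow> 'l::field" and \<sigma> +
  fixes k :: nat
  assumes char: "CHAR('k) \<noteq> 2" and odd_k: "odd k" and N_eq: "N = 2 * k"
begin

lemma k_pos: "1 \<le> k"
  using odd_k by (simp add: Suc_leI odd_pos)

lemma pow_double_k [simp]: "(\<sigma> ^^ (2 * k)) x = x" "(\<sigma> ^^ (k + k)) x = x"
  using pow_N[of x] by (simp_all only: N_eq mult_2)

lemma two_neq_0: "(2::'k) \<noteq> 0"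
proof
  assume "(2::'k) = 0"
  then have "CHAR('k) dvd 2"
    by (metis of_nat_eq_0_iff_char_dvd of_nat_numeral)
  then show False
    using char two_is_prime_nat CHAR_not_1' by (metis One_nat_def prime_nat_iff)
qed

lemma embed_2: "\<iota> 2 = 2"
  by (metis hom_add hom_one one_add_one)

lemma two_neq_0_ext: "(2::'l) \<noteq> 0"
  using two_neq_0 embed_2 embed_0 embed_eq_iff by metis

lemma eq_minus_imp_0:
  fixes z :: 'l
  assumes "z = - z"
  shows "z = 0"
proof -
  have "2 * z = 0" using assms by (metis add.right_inverse mult_2)
  then show ?thesis using two_neq_0_ext by simp
qed

text \<open>
  Here \<open>f(x, y) = Tr (\<phi>(y) x)\<close> for a linear \<open>\<phi>\<close>, which is a combination of the powers of \<open>\<sigma>\<close>;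
  antisymmetrising this expression gives \<open>2 f\<close> as a sum of skew-forms.
\<close>

lemma Alt_eq_sum_sf:
  assumes f: "f \<in> Alt \<iota>"
  shows "\<exists>c. f = (\<Sum>j<N. sf j (c j))"
proof -
  have lin: "Vector_Spaces.linear (ext_scale \<iota>) (*) (\<lambda>y. f x y)"
    "Vector_Spaces.linear (ext_scale \<iota>) (*) (\<lambda>y. f y x)" for x
    using f by (auto simp: Alt_def)
  have add: "f (x + y) z = f x z + f y z" "f z (x + y) = f z x + f z y"
    and scale: "f z (\<iota> a * x) = a * f z x" for a x y z
    using lin[of z] by (auto simp: linear_form_iff)
  have "\<forall>y. \<exists>c. \<forall>x. f x y = Tr \<iota> (c * x)"
    using functional_eq_trace[OF lin(2)] by blast
  then obtain \<phi> where \<phi>: "\<And>x y. f x y = Tr \<iota> (\<phi> y * x)"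
    by metis
  have eqI: "u = v" if "\<And>x. Tr \<iota> (u * x) = Tr \<iota> (v * x)" for u v
    using trace_form_nondegenerate[of "u - v"] that by (simp add: left_diff_distrib Tr_diff)
  have "\<phi> (x + y) = \<phi> x + \<phi> y" for x y
    by (rule eqI) (simp add: distrib_right Tr_add add flip: \<phi>)
  moreover have "\<phi> (\<iota> a * x) = \<iota> a * \<phi> x" for a x
    by (rule eqI) (simp add: mult.assoc Tr_scale scale flip: \<phi>)
  ultimately obtain b where b: "\<And>y. \<phi> y = (\<Sum>j<N. b j * (\<sigma> ^^ j) y)"
    using endomorphism_eq_pow_sum[of \<phi>] by blast
  have f_sum: "f x y = (\<Sum>j<N. Tr \<iota> (b j * (\<sigma> ^^ j) y * x))" for x y
    by (simp add: \<phi> b sum_distrib_right Tr_sum)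
  have skew: "f y x = - f x y" for x y
  proof -
    have "f x x = 0" "f y y = 0" "f (x + y) (x + y) = 0"
      using f by (auto simp: Alt_def)
    then show ?thesis by (simp add: add eq_neg_iff_add_eq_0 add.commute)
  qed
  have "f x y = (\<Sum>j<N. sf j (\<iota> (inverse 2) * b j)) x y" for x y
  proof -
    have "2 * f x y = f x y - f y x"
      by (simp add: skew[of x y])
    also have "\<dots> = (\<Sum>j<N. sf j (b j) x y)"
      unfolding f_sum sum_subtractf[symmetric] skew_form_def Tr_diff[symmetric]
      by (intro sum.cong refl arg_cong[where f = "Tr \<iota>"]) (simp add: algebra_simps)
    finally have "f x y = inverse 2 * (\<Sum>j<N. sf j (b j) x y)"
      using two_neq_0 by (simp add: field_simps)
    then show ?thesis
      by (simp add: sum_fun_apply sf_scale sum_distrib_left)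
  qed
  then show ?thesis by (intro exI[of _ "\<lambda>j. \<iota> (inverse 2) * b j"] ext)
qed

text \<open>
  Fold the sum over all exponents at \<open>k\<close>, using \<open>sf_inverse\<close>.
\<close>

lemma Alt_decomposition:
  assumes "f \<in> Alt \<iota>"
  shows "\<exists>c b. f = sf k c + (\<Sum>i\<in>{1..k-1}. sf i (b i))"
proof -
  obtain c where c: "f = (\<Sum>j<N. sf j (c j))"
    using Alt_eq_sum_sf[OF assms] by blast
  have "sf 0 (c 0) = 0"
    by (simp add: skew_form_def fun_eq_iff)
  moreover have "sf i (c i) + sf (N - i) (c (N - i)) = sf i (c i - (\<sigma> ^^ i) (c (N - i)))"
    if "i \<in> {1..k-1}" for i
  proof -
    have "i \<le> N" using that N_eq by auto
    then show ?thesis by (simp add: sf_inverse sf.diff sf.neg)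
  qed
  ultimately have "f = sf k (c k) + (\<Sum>i\<in>{1..k-1}. sf i (c i - (\<sigma> ^^ i) (c (N - i))))"
    unfolding c by (simp add: N_eq sum_lessThan_double[OF k_pos])
  then show ?thesis
    by (intro exI[of _ "c k"] exI[of _ "\<lambda>i. c i - (\<sigma> ^^ i) (c (N - i))"])
qed

text \<open>
  Only the forms for \<open>1 \<le> i < k\<close> have unique coefficients: for the involution \<open>\<sigma>\<^sup>k\<close> the two
  coefficients of \<open>sf_eq_Tr\<close> fall on the same power and only \<open>c - \<sigma>\<^sup>k(c)\<close> is determined.
\<close>

lemma Alt_decomposition_unique:
  assumes zero: "sf k c + (\<Sum>i\<in>{1..k-1}. sf i (b i)) = 0" and i: "i \<in> {1..k-1}"
  shows "b i = 0"
proof -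
  \<comment> \<open>the coefficient at \<open>\<sigma>\<^sup>j\<close> of the vanishing form, by \<open>sf_eq_Tr\<close>\<close>
  define e where "e j = (if j = 0 then 0 else if j < k then b j else if j = k then c - (\<sigma> ^^ k) c
      else - (\<sigma> ^^ j) (b (N - j)))" for j
  have e: "(\<Sum>j<N. e j * (\<sigma> ^^ j) y) = 0" for y
  proof (rule trace_form_nondegenerate)
    fix x
    have "sf k c x y = Tr \<iota> ((e k * (\<sigma> ^^ k) y) * x)"
      using k_pos by (simp add: sf_eq_Tr N_eq e_def left_diff_distrib)
    moreover have "sf i (b i) x y
        = Tr \<iota> ((e i * (\<sigma> ^^ i) y + e (N - i) * (\<sigma> ^^ (N - i)) y) * x)"
      if "i \<in> {1..k-1}" for i
    proof -
      have "i \<le> N" "i < k" "0 < i" "N - i \<noteq> 0" "\<not> N - i < k" "N - i \<noteq> k" "N - (N - i) = i"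
        using that N_eq by auto
      then show ?thesis by (simp add: sf_eq_Tr e_def)
    qed
    moreover have "e 0 = 0" by (simp add: e_def)
    ultimately have "Tr \<iota> ((\<Sum>j<N. e j * (\<sigma> ^^ j) y) * x)
        = (sf k c + (\<Sum>i\<in>{1..k-1}. sf i (b i))) x y"
      unfolding N_eq sum_lessThan_double[OF k_pos]
      by (simp add: sum_fun_apply distrib_right Tr_add sum_distrib_right Tr_sum)
    then show "Tr \<iota> ((\<Sum>j<N. e j * (\<sigma> ^^ j) y) * x) = 0"
      unfolding zero by simp
  qed
  have "i < N" using i N_eq by auto
  then have "e i = 0"
    using pow_independent[OF _ e] by simp
  moreover have "i \<noteq> 0" "i < k" using i by auto
  ultimately show ?thesis by (simp add: e_def)
qed

lemma inj_sf:
  assumes "i \<in> {1..k-1}"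
  shows "inj (sf i)"
proof (rule injI)
  fix b b' assume "sf i b = sf i b'"
  then have z: "sf i (b - b') = 0" by (simp add: sf.diff)
  have "(\<Sum>j\<in>{1..k-1}. sf j (if j = i then b - b' else 0)) = 0"
    by (intro sum.neutral) (auto simp: z sf.zero)
  then have "b - b' = 0"
    using Alt_decomposition_unique[of 0 "\<lambda>j. if j = i then b - b' else 0" i] assms
    by (simp add: sf.zero)
  then show "b = b'" by simp
qed

section \<open>Splitting the coefficients by the involution\<close>

text \<open>
  The sum \<open>\<Sum>j<N. (-1)\<^sup>j \<sigma>\<^sup>j(y)\<close> changes sign under \<open>\<sigma>\<close> because \<open>N\<close> is even, and it is nonzero for some
  \<open>y\<close> by independence.
\<close>

lemma exists_antifixed: "\<exists>\<epsilon>. \<epsilon> \<noteq> 0 \<and> \<sigma> \<epsilon> = - \<epsilon>"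
proof -
  have "\<exists>y. (\<Sum>j<N. (-1) ^ j * (\<sigma> ^^ j) y) \<noteq> 0"
  proof (rule ccontr)
    assume "\<not> ?thesis"
    then have "(-1) ^ 0 = (0::'l)"
      using N_pos by (intro pow_independent[where d = N and a = "\<lambda>j. (-1) ^ j"]) auto
    then show False by simp
  qed
  then obtain y where y: "(\<Sum>j<N. (-1) ^ j * (\<sigma> ^^ j) y) \<noteq> 0" (is "?\<epsilon> \<noteq> 0") by blast
  have sign: "\<sigma> ((-1) ^ j * x) = (-1) ^ j * \<sigma> x" for j x
    by (cases "even j") (simp_all add: pow_minus[of 1, simplified])
  have "?\<epsilon> = (\<Sum>j<Suc N. (-1) ^ j * (\<sigma> ^^ j) y) - y"
    by (simp add: N_eq)
  also have "\<dots> = (\<Sum>j<N. (-1) ^ Suc j * (\<sigma> ^^ Suc j) y)"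
    by (simp only: sum.lessThan_Suc_shift) simp
  also have "\<dots> = - \<sigma> ?\<epsilon>"
    by (simp add: pow_sum[of 1, simplified] sign sum_negf)
  finally have "\<sigma> ?\<epsilon> = - ?\<epsilon>"
    by (rule equation_minus_iff[THEN iffD1])
  with y show ?thesis by blast
qed

definition \<epsilon> :: 'l where "\<epsilon> = (SOME \<epsilon>. \<epsilon> \<noteq> 0 \<and> \<sigma> \<epsilon> = - \<epsilon>)"

lemma \<epsilon>: "\<epsilon> \<noteq> 0" "\<sigma> \<epsilon> = - \<epsilon>"
  using someI_ex[OF exists_antifixed] by (auto simp: \<epsilon>_def)

lemma pow_\<epsilon>: "(\<sigma> ^^ j) \<epsilon> = (-1) ^ j * \<epsilon>"
proof (induction j)
  case (Suc j)
  have "\<sigma> (- x) = - \<sigma> x" for x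
    using pow_minus[of 1 x] by simp
  with Suc show ?case
    by (cases "even j") (simp_all add: \<epsilon>)
qed simp

lemma pow_2: "(\<sigma> ^^ j) 2 = 2"
  using pow_embed[of j 2] by (simp add: embed_2)

lemma even_part: "((b + (\<sigma> ^^ k) b) / 2) \<in> Fix k"
  by (simp add: Fix_def pow_pow add.commute pow_2)

lemma odd_part: "(b - (\<sigma> ^^ k) b) / (2 * \<epsilon>) \<in> Fix k"
  using odd_k by (simp add: Fix_def pow_pow pow_\<epsilon> pow_2 minus_divide_left)

lemma splitting: "b = \<epsilon> * ((b - (\<sigma> ^^ k) b) / (2 * \<epsilon>)) + (b + (\<sigma> ^^ k) b) / 2"
  using \<epsilon>(1) two_neq_0_ext no_zero_divisors[OF two_neq_0_ext two_neq_0_ext] by (simp add: field_simps)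

lemma splitting_unique:
  assumes "u \<in> Fix k" "v \<in> Fix k" "\<epsilon> * u + v = 0"
  shows "u = 0" "v = 0"
proof -
  have "(\<sigma> ^^ k) (\<epsilon> * u + v) = - (\<epsilon> * u) + v"
    using assms(1,2) odd_k by (simp add: pow_\<epsilon> Fix_def)
  then have "0 = - (\<epsilon> * u) + v"
    by (simp only: assms(3) pow_0)
  then have "v = \<epsilon> * u"
    by simp
  moreover have "\<epsilon> * u = - v"
    using assms(3) by (simp add: eq_neg_iff_add_eq_0)
  ultimately have "v = - v" by simp
  then show "v = 0" by (rule eq_minus_imp_0)
  with assms(3) \<epsilon>(1) show "u = 0" by simp
qed

section \<open>Ranks of the forms in the two parts\<close>

text \<open>
  With \<open>k = 2 s + 1\<close> and \<open>\<psi> = \<sigma>\<^sup>2\<^sup>i\<close>, the map \<open>\<sigma>\<^sup>i\<close> agrees with \<open>\<psi>\<^sup>s\<^sup>+\<^sup>1\<close> on the fixed field of \<open>\<sigma>\<^sup>k\<close>.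
  Hence \<open>b / \<sigma>\<^sup>i(b) = \<Prod>j\<le>s. \<psi>\<^sup>j(b) / \<psi>\<^sup>j\<^sup>+\<^sup>1(b) = \<psi>(x) / x\<close> for \<open>x = (\<Prod>j\<le>s. \<psi>\<^sup>j(b))\<^sup>-\<^sup>1\<close>.
\<close>

lemma radical_solution:
  assumes b: "b \<in> Fix k" "b \<noteq> 0"
  obtains x where "x \<noteq> 0" "b * x = (\<sigma> ^^ i) b * (\<sigma> ^^ (2 * i)) x"
proof -
  obtain s where s: "k = 2 * s + 1" using odd_k by (elim oddE)
  let ?P = "\<Prod>j<Suc s. (\<sigma> ^^ (2 * i * j)) b"
  have "(\<sigma> ^^ (2 * i * Suc s)) b = (\<sigma> ^^ (i + k * i)) b"
    by (simp add: s algebra_simps)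
  also have "\<dots> = (\<sigma> ^^ i) b"
    using Fix_mult[OF b(1)] by (simp flip: pow_pow)
  finally have last: "(\<sigma> ^^ (2 * i * Suc s)) b = (\<sigma> ^^ i) b" .
  have "(\<sigma> ^^ (2 * i)) ?P = (\<Prod>j<Suc s. (\<sigma> ^^ (2 * i * Suc j)) b)"
    by (simp add: pow_pow)
  then have "b * (\<sigma> ^^ (2 * i)) ?P = (\<Prod>j<Suc (Suc s). (\<sigma> ^^ (2 * i * j)) b)"
    by (simp only: prod.lessThan_Suc_shift[of _ "Suc s"]) simp
  also have "\<dots> = ?P * (\<sigma> ^^ i) b"
    by (simp only: prod.lessThan_Suc[of _ "Suc s"] last)
  finally have P: "b * (\<sigma> ^^ (2 * i)) ?P = ?P * (\<sigma> ^^ i) b" .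
  have "?P \<noteq> 0" using b(2) by simp
  then have "b * inverse ?P = (\<sigma> ^^ i) b * (\<sigma> ^^ (2 * i)) (inverse ?P)"
    using P by (simp only: pow_inverse) (simp add: field_simps del: pow_prod)
  with \<open>?P \<noteq> 0\<close> show ?thesis by (intro that[of "inverse ?P"]) simp_all
qed

text \<open>
  Two solutions of the equation for the radical differ by a factor fixed by \<open>\<sigma>\<^sup>2\<^sup>i\<close>.
\<close>

lemma dim_radical_fixed:
  assumes "b \<in> Fix k" "b \<noteq> 0"
  shows "L.dim (radical (sf i b)) = L.dim (Fix (2 * i))"
proof -
  obtain x where x: "x \<noteq> 0" "b * x = (\<sigma> ^^ i) b * (\<sigma> ^^ (2 * i)) x"
    using radical_solution[OF assms] by blast
  have iff: "x * z \<in> radical (sf i b) \<longleftrightarrow> z \<in> Fix (2 * i)" for z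
  proof -
    have "x * z \<in> radical (sf i b)
        \<longleftrightarrow> b * x * z = (\<sigma> ^^ i) b * (\<sigma> ^^ (2 * i)) x * (\<sigma> ^^ (2 * i)) z"
      by (simp add: radical_sf mult.assoc)
    also have "\<dots> \<longleftrightarrow> b * x * z = b * x * (\<sigma> ^^ (2 * i)) z"
      by (simp only: x(2))
    finally show ?thesis using assms(2) x(1) by (auto simp: Fix_def)
  qed
  have "radical (sf i b) = (*) x ` Fix (2 * i)"
  proof (intro equalityI subsetI)
    fix y assume y: "y \<in> radical (sf i b)"
    show "y \<in> (*) x ` Fix (2 * i)"
    proof (rule image_eqI)
      show "y = x * (y / x)" using x(1) by simp
      with y show "y / x \<in> Fix (2 * i)" by (simp flip: iff)
    qed
  qed (auto simp: iff)
  then show ?thesis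
    using dim_image_eq[OF linear_mult, of x] x(1) by (simp add: inj_on_def)
qed

text \<open>
  The quotient of a solution for \<open>\<epsilon> b\<close> and a nonzero solution for \<open>b\<close> is negated by \<open>\<sigma>\<^sup>2\<^sup>i\<close>, because
  \<open>\<sigma>\<^sup>i(\<epsilon>) = -\<epsilon>\<close>. Applying \<open>\<sigma>\<^sup>2\<^sup>i\<close> an odd number \<open>k\<close> of times gives the identity, so the quotient is
  its own negative.
\<close>

lemma radical_antifixed:
  assumes b: "b \<in> Fix k" "b \<noteq> 0" and i: "odd i"
  shows "radical (sf i (\<epsilon> * b)) = {0}"
proof -
  obtain x where x: "x \<noteq> 0" "b * x = (\<sigma> ^^ i) b * (\<sigma> ^^ (2 * i)) x"
    using radical_solution[OF b] by blast
  have "y = 0" if "y \<in> radical (sf i (\<epsilon> * b))" for y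
  proof -
    define z where "z = y / x"
    then have y: "y = x * z" using x(1) by simp
    have "\<epsilon> * (b * x * z)
        = \<epsilon> * (- ((\<sigma> ^^ i) b * (\<sigma> ^^ (2 * i)) x * (\<sigma> ^^ (2 * i)) z))"
      using that i unfolding radical_sf y by (simp add: pow_\<epsilon> mult_ac)
    then have "\<epsilon> * (b * x * z) = \<epsilon> * (- (b * x * (\<sigma> ^^ (2 * i)) z))"
      by (simp only: x(2))
    then have "b * x * z = - (b * x * (\<sigma> ^^ (2 * i)) z)"
      by (simp only: mult_left_cancel[OF \<epsilon>(1)])
    then have "b * x * z = b * x * (- (\<sigma> ^^ (2 * i)) z)"
      by (simp only: mult_minus_right)
    moreover have "b * x \<noteq> 0"
      using b(2) x(1) by simp
    ultimately have "z = - (\<sigma> ^^ (2 * i)) z"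
      by (metis mult_left_cancel)
    then have z: "(\<sigma> ^^ (2 * i)) z = - z" by (metis minus_minus)
    have "(\<sigma> ^^ (2 * i * j)) z = (-1) ^ j * z" for j
    proof (induction j)
      case (Suc j)
      have "(\<sigma> ^^ (2 * i * Suc j)) z = (\<sigma> ^^ (2 * i * j)) ((\<sigma> ^^ (2 * i)) z)"
        by (simp add: pow_pow add.commute)
      then show ?case by (simp add: z Suc)
    qed simp
    from this[of k] have "(\<sigma> ^^ (N * i)) z = - z"
      using odd_k by (simp add: N_eq mult_ac)
    moreover have "(\<sigma> ^^ (N * i)) z = z"
      by (rule Fix_mult) (simp add: Fix_def)
    ultimately have "z = 0" by (intro eq_minus_imp_0) (rule trans[OF sym])
    then show "y = 0" by (simp add: y)
  qed
  moreover have "0 \<in> radical (sf i (\<epsilon> * b))" by (simp add: radical_sf)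
  ultimately show ?thesis by blast
qed

definition U :: "nat \<Rightarrow> ('l \<Rightarrow> 'l \<Rightarrow> 'k) set" where
  "U i = (\<lambda>u. sf i (\<epsilon> * u)) ` Fix k"

definition V :: "nat \<Rightarrow> ('l \<Rightarrow> 'l \<Rightarrow> 'k) set" where
  "V i = sf i ` Fix k"

lemma linear_sf_\<epsilon>: "Vector_Spaces.linear (ext_scale \<iota>) form_scale (\<lambda>u. sf i (\<epsilon> * u))"
  using Vector_Spaces.linear_compose[OF linear_mult[of \<epsilon>] linear_sf[of i]] by (simp add: o_def)

sublocale sf_\<epsilon>: Vector_Spaces.linear "ext_scale \<iota>" form_scale "\<lambda>u. sf i (\<epsilon> * u)" for i
  by (rule linear_sf_\<epsilon>)

lemma subspace_U: "F.subspace (U i)"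
  unfolding U_def by (rule sf_\<epsilon>.subspace_image[OF subspace_Fix])

lemma subspace_V: "F.subspace (V i)"
  unfolding V_def by (rule sf.subspace_image[OF subspace_Fix])

lemma dim_Fix_k: "L.dim (Fix k) = k"
  by (rule dim_Fix) (simp add: N_eq)

lemma dim_U:
  assumes "i \<in> {1..k-1}"
  shows "F.dim (U i) = k"
proof -
  have "inj (\<lambda>u. sf i (\<epsilon> * u))"
    using \<epsilon>(1) injD[OF inj_sf[OF assms]] by (intro injI) (metis mult_left_cancel)
  then show ?thesis
    unfolding U_def by (subst dim_image_eq[OF linear_sf_\<epsilon>]) (auto simp: dim_Fix_k)
qed

lemma dim_V: "i \<in> {1..k-1} \<Longrightarrow> F.dim (V i) = k"
  unfolding V_def by (subst dim_image_eq[OF linear_sf inj_sf]) (auto simp: dim_Fix_k)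

abbreviation od :: "nat \<Rightarrow> nat" where
  "od i \<equiv> group.ord (Gal \<iota>) (\<sigma> ^^ i)"

lemma od_eq: "1 \<le> i \<Longrightarrow> od i = N div gcd N i"
  using G.ord_pow_gen[OF generator(1), of i] by (simp add: pow_Gal)

text \<open>
  If \<open>i\<close> is even, then \<open>(\<sigma>\<^sup>i)\<^sup>k = id\<close>, so the order divides the odd number \<open>k\<close>.
\<close>

lemma odd_of_even_od:
  assumes "1 \<le> i" "even (od i)"
  shows "odd i"
proof
  assume "even i"
  then obtain j where j: "i = 2 * j" by blast
  have "od i = k div gcd k j"
    unfolding od_eq[OF assms(1)] N_eq unfolding j by (simp flip: gcd_mult_distrib_nat)
  then have "od i dvd k"
    by (metis dvd_triv_right dvd_div_mult_self gcd_dvd1 mult.commute)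
  with odd_k assms(2) show False by (meson dvd_trans)
qed

text \<open>
  With \<open>g = gcd k i\<close> and \<open>k = g m\<close>, the order is \<open>2 m\<close> and the fixed field of \<open>\<sigma>\<^sup>2\<^sup>i\<close> is that of
  \<open>\<sigma>\<^sup>2\<^sup>g\<close>, of degree \<open>2 g = 4 g m / (2 m)\<close>.
\<close>

lemma dim_Fix_double:
  assumes "odd i"
  shows "L.dim (Fix (2 * i)) = 2 * N div od i"
proof -
  have i: "1 \<le> i" using assms by (simp add: Suc_leI odd_pos)
  define g where "g = gcd k i"
  obtain m where m: "k = g * m" unfolding g_def by (meson dvdE gcd_dvd1)
  have pos: "0 < g" "0 < m" using m k_pos by (auto intro!: gr0I)
  have "coprime 2 i" using assms by simp
  then have "gcd N i = g"
    unfolding N_eq g_def by (metis coprime_commute gcd_mult_left_left_cancel)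
  then have "od i = 2 * m"
    using pos by (simp add: od_eq[OF i] N_eq m)
  moreover have "gcd (2 * i) N = 2 * g"
    by (simp add: N_eq g_def gcd.commute flip: gcd_mult_distrib_nat)
  moreover have "L.dim (Fix (2 * i)) = gcd (2 * i) N"
    using i by (subst Fix_gcd) (auto intro: dim_Fix)
  ultimately show ?thesis
    using pos by (simp add: N_eq m)
qed

lemma rank_U:
  assumes "odd i"
  shows "rank_subspace \<iota> N (U i)"
proof -
  have "L.dim {0} = 0"
    by (rule L.dim_unique[of "{}"]) (auto simp: L.independent_empty)
  then have "form_rank \<iota> (sf i (\<epsilon> * u)) = N" if "u \<in> Fix k" "u \<noteq> 0" for u
    using radical_antifixed[OF that assms] by (simp add: form_rank_def degree_eq)
  moreover have "\<exists>u\<in>Fix k. u \<noteq> 0 \<and> f = sf i (\<epsilon> * u)" if f: "f \<in> U i" "f \<noteq> 0" for f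
  proof -
    obtain u where u: "u \<in> Fix k" "f = sf i (\<epsilon> * u)"
      using f(1) unfolding U_def by blast
    then have "u \<noteq> 0"
      using f(2) by (auto simp: sf.zero)
    with u show ?thesis by blast
  qed
  ultimately have "form_rank \<iota> f = N" if "f \<in> U i" "f \<noteq> 0" for f
    using that by blast
  then show ?thesis
    using subspace_U by (auto simp: rank_subspace_def U_def sf_in_Alt)
qed

lemma rank_V:
  assumes "odd i"
  shows "rank_subspace \<iota> (N - 2 * N div od i) (V i)"
proof -
  have "form_rank \<iota> (sf i v) = N - 2 * N div od i" if "v \<in> Fix k" "v \<noteq> 0" for v
    using dim_radical_fixed[OF that, of i] dim_Fix_double[OF assms]
    by (simp add: form_rank_def degree_eq)
  moreover have "\<exists>u\<in>Fix k. u \<noteq> 0 \<and> f = sf i u" if f: "f \<in> V i" "f \<noteq> 0" for f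
  proof -
    obtain u where u: "u \<in> Fix k" "f = sf i u"
      using f(1) unfolding V_def by blast
    then have "u \<noteq> 0"
      using f(2) by (auto simp: sf.zero)
    with u show ?thesis by blast
  qed
  ultimately have "form_rank \<iota> f = N - 2 * N div od i" if "f \<in> V i" "f \<noteq> 0" for f
    using that by blast
  then show ?thesis
    using subspace_V by (auto simp: rank_subspace_def V_def sf_in_Alt)
qed

section \<open>The direct sum decomposition\<close>

lemma od_neq_2:
  assumes "i \<in> {1..k-1}"
  shows "od i \<noteq> 2"
proof
  assume "od i = 2"
  then have "(\<sigma> ^^ i) [^]\<^bsub>Gal \<iota>\<^esub> (2::nat) = \<one>\<^bsub>Gal \<iota>\<^esub>"
    using G.pow_ord_eq_1[OF pow_in_Gal[of i]] by simp
  then have "\<sigma> [^]\<^bsub>Gal \<iota>\<^esub> (i * 2) = \<one>\<^bsub>Gal \<iota>\<^esub>"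
    by (simp only: pow_Gal[symmetric] G.nat_pow_pow[OF generator(1)])
  then have "k dvd i"
    unfolding G.pow_eq_id[OF generator(1)] N_eq by (simp add: mult.commute)
  then show False
    using assms by (auto dest: dvd_imp_le)
qed

definition I_even :: "nat set" where "I_even = {i\<in>{1..k-1}. even (od i) \<and> od i \<noteq> 2}"

definition I_odd :: "nat set" where "I_odd = {i\<in>{1..k-1}. odd (od i)}"

lemma sum_I_even_odd:
  "(\<Sum>i\<in>I_even. h i) + (\<Sum>i\<in>I_odd. h' i)
    = (\<Sum>i\<in>{1..k-1}. if i \<in> I_even then h i else h' i)"
  for h h' :: "nat \<Rightarrow> 'c::comm_monoid_add"
proof -
  have parts: "{1..k-1} = I_even \<union> I_odd" "I_even \<inter> I_odd = {}" "finite I_even" "finite I_odd"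
    using od_neq_2 by (auto simp: I_even_def I_odd_def)
  show ?thesis
    unfolding parts(1) sum.union_disjoint[OF parts(3,4,2)] using parts(2)
    by (intro arg_cong2[of _ _ _ _ "(+)"] sum.cong) auto
qed

lemma sum_summands:
  fixes w :: "summand \<Rightarrow> 'c::comm_monoid_add"
  shows "(\<Sum>s\<in>{SB} \<union> SU ` I_even \<union> SV ` I_even \<union> SA ` I_odd. w s)
    = w SB + (\<Sum>i\<in>{1..k-1}. if i \<in> I_even then w (SU i) + w (SV i) else w (SA i))"
proof -
  have fin: "finite I_even" "finite I_odd" by (auto simp: I_even_def I_odd_def)
  have VA: "sum w (SV ` I_even \<union> SA ` I_odd) = sum w (SV ` I_even) + sum w (SA ` I_odd)"
    by (rule sum.union_disjoint) (use fin in auto)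
  have "sum w (SU ` I_even \<union> (SV ` I_even \<union> SA ` I_odd))
      = sum w (SU ` I_even) + sum w (SV ` I_even \<union> SA ` I_odd)"
    by (rule sum.union_disjoint) (use fin in auto)
  moreover have "SB \<notin> SU ` I_even \<union> (SV ` I_even \<union> SA ` I_odd)" by auto
  ultimately have "sum w ({SB} \<union> SU ` I_even \<union> SV ` I_even \<union> SA ` I_odd)
    = w SB + (sum w (SU ` I_even) + (sum w (SV ` I_even) + sum w (SA ` I_odd)))"
    using fin by (simp add: VA Un_assoc)
  also have "\<dots> = w SB + ((\<Sum>i\<in>I_even. w (SU i) + w (SV i)) + (\<Sum>i\<in>I_odd. w (SA i)))"
    by (simp add: sum.reindex inj_on_def sum.distrib add.assoc)
  finally show ?thesis by (simp only: sum_I_even_odd)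
qed

definition W :: "summand \<Rightarrow> ('l \<Rightarrow> 'l \<Rightarrow> 'k) set" where
  "W s = (case s of SB \<Rightarrow> A_space \<iota> (\<sigma> ^^ k) | SU i \<Rightarrow> U i | SV i \<Rightarrow> V i
    | SA i \<Rightarrow> A_space \<iota> (\<sigma> ^^ i))"

lemma subspace_A: "F.subspace (A_space \<iota> (\<sigma> ^^ i))"
  unfolding range_sf by (rule sf.subspace_image[OF L.subspace_UNIV])

lemma subspace_W: "F.subspace (W s)"
  by (cases s) (simp_all add: W_def subspace_A subspace_U subspace_V)

lemma W_subset_Alt: "W s \<subseteq> Alt \<iota>"
  by (cases s) (auto simp: W_def U_def V_def range_sf sf_in_Alt)

lemma subspace_Alt: "F.subspace (Alt \<iota>)"
  by (rule F.subspaceI)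
    (auto simp: Alt_def form_scale_def linear_form_iff algebra_simps)

text \<open>
  The coefficient of a decomposition at \<open>\<sigma>\<^sup>i\<close> is unique; for even order it splits uniquely into its
  parts in \<open>\<epsilon> Fix k\<close> and \<open>Fix k\<close>.
\<close>

lemma direct_sum_Alt:
  "internal_direct_sum (Alt \<iota>) ({SB} \<union> SU ` I_even \<union> SV ` I_even \<union> SA ` I_odd) W"
  (is "internal_direct_sum _ ?I _")
proof (rule internal_direct_sumI)
  show "finite ?I" by (simp add: I_even_def I_odd_def)
  show "f - g \<in> W s" if "f \<in> W s" "g \<in> W s" for s f g
    using that by (rule F.subspace_diff[OF subspace_W])
  show "sum w ?I \<in> Alt \<iota>" if "\<And>s. s \<in> ?I \<Longrightarrow> w s \<in> W s" for w
    using that W_subset_Alt by (intro F.subspace_sum[OF subspace_Alt]) blast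
next
  fix w assume w: "\<And>s. s \<in> ?I \<Longrightarrow> w s \<in> W s" and zero: "sum w ?I = 0"
  have "w SB \<in> range (sf k)"
    using w[of SB] by (simp add: W_def range_sf)
  then obtain c where c: "w SB = sf k c" by blast
  have "\<forall>i\<in>I_even. \<exists>u\<in>Fix k. w (SU i) = sf i (\<epsilon> * u)" "\<forall>i\<in>I_even. \<exists>v\<in>Fix k. w (SV i) = sf i v"
    using w[of "SU _"] w[of "SV _"] by (auto simp: W_def U_def V_def image_iff)
  then obtain u v where uv: "\<And>i. i \<in> I_even \<Longrightarrow> u i \<in> Fix k"
    "\<And>i. i \<in> I_even \<Longrightarrow> w (SU i) = sf i (\<epsilon> * u i)"
    "\<And>i. i \<in> I_even \<Longrightarrow> v i \<in> Fix k" "\<And>i. i \<in> I_even \<Longrightarrow> w (SV i) = sf i (v i)"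
    by metis
  have "\<forall>i\<in>I_odd. \<exists>a. w (SA i) = sf i a"
    using w[of "SA _"] by (auto simp: W_def range_sf image_iff)
  then obtain a where a: "\<And>i. i \<in> I_odd \<Longrightarrow> w (SA i) = sf i (a i)" by metis
  define b where "b i = (if i \<in> I_even then \<epsilon> * u i + v i else a i)" for i
  have split: "i \<in> I_even \<or> i \<in> I_odd" if "i \<in> {1..k-1}" for i
    using that od_neq_2 by (auto simp: I_even_def I_odd_def)
  have terms: "(if i \<in> I_even then w (SU i) + w (SV i) else w (SA i)) = sf i (b i)"
    if "i \<in> {1..k-1}" for i
    using split[OF that] by (auto simp: b_def uv a sf.add)
  have "sum w ?I = sf k c + (\<Sum>i\<in>{1..k-1}. sf i (b i))"
    unfolding sum_summands c by (simp only: sum.cong[OF refl terms])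
  then have b0: "b i = 0" if "i \<in> {1..k-1}" for i
    using Alt_decomposition_unique[OF _ that, of c b] zero by simp
  have E0: "w (SU i) = 0 \<and> w (SV i) = 0" if "i \<in> I_even" for i
  proof -
    have "\<epsilon> * u i + v i = 0"
      using b0[of i] that by (simp add: b_def I_even_def)
    from splitting_unique[OF uv(1,3)[OF that] this] show ?thesis
      by (simp add: uv that sf.zero)
  qed
  have O0: "w (SA i) = 0" if "i \<in> I_odd" for i
  proof -
    have "i \<notin> I_even" "i \<in> {1..k-1}" using that by (auto simp: I_even_def I_odd_def)
    then have "a i = 0" using b0[of i] by (simp add: b_def)
    then show ?thesis by (simp add: a that sf.zero)
  qed
  have terms_0: "(if i \<in> I_even then w (SU i) + w (SV i) else w (SA i)) = 0" if "i \<in> {1..k-1}" for i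
    using split[OF that] E0 O0 by auto
  have "w SB = sum w ?I"
    unfolding sum_summands by (simp only: sum.cong[OF refl terms_0] sum.neutral_const add_0_right)
  then show "\<forall>s\<in>?I. w s = 0"
    using zero E0 O0 by auto
next
  fix f assume "f \<in> Alt \<iota>"
  then obtain c b where f: "f = sf k c + (\<Sum>i\<in>{1..k-1}. sf i (b i))"
    using Alt_decomposition by blast
  define w where "w s = (case s of SB \<Rightarrow> sf k c
    | SU i \<Rightarrow> sf i (\<epsilon> * ((b i - (\<sigma> ^^ k) (b i)) / (2 * \<epsilon>)))
    | SV i \<Rightarrow> sf i ((b i + (\<sigma> ^^ k) (b i)) / 2)
    | SA i \<Rightarrow> sf i (b i))" for s
  have "sf i (\<epsilon> * ((b i - (\<sigma> ^^ k) (b i)) / (2 * \<epsilon>))) \<in> U i" for i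
    unfolding U_def by (rule image_eqI[OF refl odd_part])
  moreover have "sf i ((b i + (\<sigma> ^^ k) (b i)) / 2) \<in> V i" for i
    unfolding V_def by (rule imageI[OF even_part])
  ultimately have "w s \<in> W s" for s
    by (cases s) (simp only: w_def W_def summand.case range_sf; blast)+
  moreover have "w (SU i) + w (SV i) = sf i (b i)" for i
    unfolding w_def summand.case sf.add[symmetric] splitting[symmetric] ..
  then have "sum w ?I = f"
    unfolding sum_summands f by (auto simp: w_def intro!: sum.cong)
  ultimately show "\<exists>w. (\<forall>s\<in>?I. w s \<in> W s) \<and> sum w ?I = f"
    by blast
qed

end

theorem corollary4p2:
  fixes \<iota> :: "'k::field \<Rightarrow> 'l::field" and \<sigma> :: "'l \<Rightarrow> 'l" and n k :: nat
  assumes char: "CHAR('k) \<noteq> 2"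
    and k: "k \<ge> 1" "odd k"
    and n: "n = 2 * k"
    and galois: "finite_galois \<iota>"
    and degree: "degree_ext \<iota> = n"
    and cyclic: "\<sigma> \<in> carrier (Gal \<iota>)" "carrier (Gal \<iota>) = generate (Gal \<iota>) {\<sigma>}"
  defines "A \<equiv> \<lambda>i::nat. A_space \<iota> (\<sigma> [^]\<^bsub>Gal \<iota>\<^esub> i)"
    and "B1 \<equiv> A_space \<iota> (\<sigma> [^]\<^bsub>Gal \<iota>\<^esub> (n div 2))"
    and "od \<equiv> \<lambda>i::nat. group.ord (Gal \<iota>) (\<sigma> [^]\<^bsub>Gal \<iota>\<^esub> i)"
  shows "\<exists>U V :: nat \<Rightarrow> ('l \<Rightarrow> 'l \<Rightarrow> 'k) set.
     (\<forall>i\<in>{1..k-1}. even (od i) \<and> od i \<noteq> 2 \<longrightarrow>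
        U i \<subseteq> A i \<and> rank_subspace \<iota> n (U i) \<and> form_dim (U i) = n div 2 \<and>
        V i \<subseteq> A i \<and> rank_subspace \<iota> (n - 2 * n div od i) (V i) \<and> form_dim (V i) = n div 2) \<and>
     internal_direct_sum (Alt \<iota>)
       ({SB} \<union> SU ` {i\<in>{1..k-1}. even (od i) \<and> od i \<noteq> 2}
             \<union> SV ` {i\<in>{1..k-1}. even (od i) \<and> od i \<noteq> 2}
             \<union> SA ` {i\<in>{1..k-1}. odd (od i)})
       (\<lambda>s. case s of SB \<Rightarrow> B1 | SU i \<Rightarrow> U i | SV i \<Rightarrow> V i | SA i \<Rightarrow> A i)"
proof -
  interpret field_extension \<iota>
    using galois by (simp add: finite_galois_def)
  interpret C: cyclic_galois \<iota> \<sigma>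
    by unfold_locales (fact galois cyclic)+
  interpret T: cyclic_galois_twice_odd \<iota> \<sigma> k
    using C.degree_eq degree n char k by unfold_locales auto
  have N: "C.N = n" using C.degree_eq degree by simp
  have od: "od i = T.od i" and A: "A i = range (C.sf i)" and B1: "B1 = A_space \<iota> (\<sigma> ^^ k)" for i
    by (simp_all add: od_def A_def B1_def n C.pow_Gal C.range_sf)
  show ?thesis
  proof (intro exI conjI ballI impI)
    fix i assume i: "i \<in> {1..k-1}" and even: "even (od i) \<and> od i \<noteq> 2"
    have "odd i"
      using T.odd_of_even_od[of i] i even od by auto
    then show "rank_subspace \<iota> n (T.U i)" "rank_subspace \<iota> (n - 2 * n div od i) (T.V i)"
      using T.rank_U[of i] T.rank_V[of i] by (simp_all add: N od)
    show "T.U i \<subseteq> A i" "T.V i \<subseteq> A i"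
      by (auto simp: A T.U_def T.V_def)
    show "form_dim (T.U i) = n div 2" "form_dim (T.V i) = n div 2"
      using T.dim_U[OF i] T.dim_V[OF i] by (simp_all add: n)
  next
    have "T.W = (\<lambda>s. case s of SB \<Rightarrow> B1 | SU i \<Rightarrow> T.U i | SV i \<Rightarrow> T.V i | SA i \<Rightarrow> A i)"
      by (auto simp: fun_eq_iff T.W_def A B1 C.range_sf split: summand.split)
    then show "internal_direct_sum (Alt \<iota>)
       ({SB} \<union> SU ` {i\<in>{1..k-1}. even (od i) \<and> od i \<noteq> 2}
             \<union> SV ` {i\<in>{1..k-1}. even (od i) \<and> od i \<noteq> 2}
             \<union> SA ` {i\<in>{1..k-1}. odd (od i)})
       (\<lambda>s. case s of SB \<Rightarrow> B1 | SU i \<Rightarrow> T.U i | SV i \<Rightarrow> T.V i | SA i \<Rightarrow> A i)"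
      using T.direct_sum_Alt by (simp add: T.I_even_def T.I_odd_def od)
  qed
qed

end
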